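(* Let $N\geqslant 1$. For every integer $d\geqslant 1$ and every jet order $k\geqslant d-1$, one has $$\dim_{\mathbb{C}} H^0\Big(\mathbb{P}^N(\mathbb{C}),\ \bigoplus_{n=0}^{\infty}E^{\mathrm{GG}}_{k,n}\otimes\mathcal{O}(d)\Big)=(N+1)^d .$$
   Context: Let $[X_0:\dots:X_N]$ be homogeneous coordinates on $\mathbb{P}^N=\mathbb{P}^N(\mathbb{C})$ and $U_i=\{X_i\neq 0\}$, with affine coordinates $X_j/X_i$ ($j\neq i$). Green-Griffiths bundle $E^{\mathrm{GG}}_{k,n}$ (jet order $k$, weight $n$): in a chart with coordinates $(x_1,\dots,x_N)$, introduce formal jet variables $x_i^{(l)}$, $1\leqslant i\leqslant N$, $1\leqslant l\leqslant k$, and give $x_i^{(l)}$ weight $l$. A local holomorphic section of $E^{\mathrm{GG}}_{k,n}$ over an open set $V$ of the chart is a polynomial in these jet variables, with coefficients holomorphic functions on $V$, all of whose monomials have weight $n$. If $y_t=\Psi_t(x_1,\dots,x_N)$ is a change of charts, then $y_t^{(l)}$ is identified with the expression $(\Psi_t(x_1,\dots,x_N))^{(l)}$ obtained by formally differentiating $l$ times with the chain rule, $x_1,\dots,x_N$ being regarded as functions of one variable with successive derivatives $x_i^{(1)},x_i^{(2)},\dots$. (So $E^{\mathrm{GG}}_{k,0}$ is the trivial line bundle, and $E^{\mathrm{GG}}_{0,n}=0$ for $n\geqslant1$.) $\mathcal{O}(d)$ is the line bundle on $\mathbb{P}^N$ trivialized over each $U_i$ whose sections are tuples $(s_0,\dots,s_N)$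 with $s_i=(X_j/X_i)^d s_j$ on $U_i\cap U_j$. Thus a global section of $\bigoplus_n E^{\mathrm{GG}}_{k,n}\otimes\mathcal{O}(d)$ is a tuple $(s_0,\dots,s_N)$, with $s_i$ a polynomial in the jet variables of $U_i$ with coefficients holomorphic on $U_i$, satisfying $s_i=(X_j/X_i)^d s_j$ on $U_i\cap U_j$ after the change of charts. *)

theory Defs
  imports "HOL-Analysis.Analysis" "HOL-Library.Poly_Mapping" "HOL-Library.Function_Algebras"
begin

text \<open>
  The finite type \<open>'n\<close> indexes the homogeneous coordinates of projective space, so that
  \<open>CARD('n) = N + 1\<close>.  The affine coordinates \<open>x\<^sub>t = X\<^sub>t / X\<^sub>i\<close> on \<open>U\<^sub>i\<close> exist only for
  \<open>t \<noteq> i\<close>.  All charts are nevertheless modelled on the single type \<open>complex ^ 'n\<close>: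
  the slot \<open>i\<close> of a point of the chart \<open>U\<^sub>i\<close> is a dummy, and functions on \<open>U\<^sub>i\<close> are
  required not to depend on it.
\<close>

text \<open>The homogeneous representative, with \<open>X\<^sub>i = 1\<close>, of a point of \<open>U\<^sub>i\<close>.\<close>

definition homog :: "'n::finite \<Rightarrow> complex ^ 'n \<Rightarrow> complex ^ 'n" where
  "homog i x = (\<chi> t. if t = i then 1 else x $ t)"

text \<open>The image of \<open>U\<^sub>i \<inter> U\<^sub>j\<close> in the chart \<open>U\<^sub>i\<close>, i.e. \<open>X\<^sub>j / X\<^sub>i \<noteq> 0\<close>.\<close>

definition overlap :: "'n::finite \<Rightarrow> 'n \<Rightarrow> (complex ^ 'n) set" where
  "overlap i j = {x. homog i x $ j \<noteq> 0}"

text \<open>The change of charts from \<open>U\<^sub>i\<close> to \<open>U\<^sub>j\<close>, with components \<open>(X\<^sub>t / X\<^sub>i) / (X\<^sub>j / X\<^sub>i)\<close>;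
  it is meaningful on \<open>overlap i j\<close> only.\<close>

definition transition :: "'n::finite \<Rightarrow> 'n \<Rightarrow> complex ^ 'n \<Rightarrow> complex ^ 'n" where
  "transition i j x = (\<chi> t. homog i x $ t / homog i x $ j)"

text \<open>Holomorphy in several variables: the real Frechet derivative exists and is complex linear.\<close>

definition holomorphic_several :: "(complex ^ 'n::finite \<Rightarrow> complex) \<Rightarrow> (complex ^ 'n) set \<Rightarrow> bool" where
  "holomorphic_several f V \<longleftrightarrow>
     (\<forall>x\<in>V. \<exists>f'. (f has_derivative f') (at x) \<and> (\<forall>c v. f' (c *s v) = c * f' v))"

definition chart_function :: "'n::finite \<Rightarrow> (complex ^ 'n \<Rightarrow> complex) \<Rightarrow> bool" where
  "chart_function i f \<longleftrightarrow> holomorphic_several f UNIV \<and> (\<forall>x. f (homog i x) = f x)"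

definition partial_deriv :: "'n::finite \<Rightarrow> (complex ^ 'n \<Rightarrow> complex) \<Rightarrow> complex ^ 'n \<Rightarrow> complex" where
  "partial_deriv t f x = deriv (\<lambda>z. f (\<chi> m. if m = t then z else x $ m)) (x $ t)"

text \<open>The pair \<open>(t, l)\<close> stands for the formal jet variable written \<open>x\<^sub>t\<close> with upper index \<open>(l)\<close>,
  a monomial is its finitely supported exponent function, and a polynomial in the jet variables
  maps monomials to coefficients, which are functions of the chart coordinates.\<close>

type_synonym 'n jet_monomial = "('n \<times> nat) \<Rightarrow>\<^sub>0 nat"
type_synonym 'n jet_poly = "'n jet_monomial \<Rightarrow>\<^sub>0 (complex ^ 'n \<Rightarrow> complex)"

definition coeff_poly :: "(complex ^ 'n \<Rightarrow> complex) \<Rightarrow> 'n::finite jet_poly" where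
  "coeff_poly f = Poly_Mapping.single 0 f"

definition jet_var :: "'n \<Rightarrow> nat \<Rightarrow> 'n::finite jet_poly" where
  "jet_var t l = Poly_Mapping.single (Poly_Mapping.single (t, l) 1) 1"

definition jet_weight :: "'n jet_monomial \<Rightarrow> nat" where
  "jet_weight m = (\<Sum>(t, l)\<in>Poly_Mapping.keys m. l * Poly_Mapping.lookup m (t, l))"

text \<open>The sections over \<open>U\<^sub>i\<close> of the Green-Griffiths bundle of jet order \<open>k\<close> and weight \<open>n\<close>.\<close>

definition GG_chart :: "nat \<Rightarrow> nat \<Rightarrow> 'n::finite \<Rightarrow> 'n jet_poly set" where
  "GG_chart k n i =
     {P. \<forall>m\<in>Poly_Mapping.keys P.
           chart_function i (Poly_Mapping.lookup P m) \<and>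
           Poly_Mapping.keys m \<subseteq> {(t, l). t \<noteq> i \<and> 1 \<le> l \<and> l \<le> k} \<and>
           jet_weight m = n}"

definition GG_sum_chart :: "nat \<Rightarrow> 'n::finite \<Rightarrow> 'n jet_poly set" where
  "GG_sum_chart k i = {\<Sum>n<M. p n | M p. \<forall>n<M. p n \<in> GG_chart k n i}"

text \<open>Formal differentiation in the chart \<open>U\<^sub>i\<close>: a coefficient \<open>f\<close> goes to the sum over \<open>t\<close> of
  its partial derivatives times the first-order jet variables, the jet variable \<open>(t, l)\<close> goes to
  \<open>(t, l + 1)\<close>, and the Leibniz rule holds.\<close>

definition total_deriv :: "'n::finite \<Rightarrow> 'n jet_poly \<Rightarrow> 'n jet_poly" where
  "total_deriv i P =
     (\<Sum>m\<in>Poly_Mapping.keys P.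
        (\<Sum>t\<in>- {i}. Poly_Mapping.single m (partial_deriv t (Poly_Mapping.lookup P m)) * jet_var t 1) +
        (\<Sum>(t, l)\<in>Poly_Mapping.keys m.
            Poly_Mapping.single (m - Poly_Mapping.single (t, l) 1)
              (\<lambda>x. of_nat (Poly_Mapping.lookup m (t, l)) * Poly_Mapping.lookup P m x)
            * jet_var t (Suc l)))"

text \<open>\<open>chart_change i j P\<close> rewrites a polynomial \<open>P\<close> in the jet variables of \<open>U\<^sub>j\<close> in the jet
  variables of \<open>U\<^sub>i\<close>, replacing each \<open>(t, l)\<close> by the \<open>l\<close>-th formal derivative of the \<open>t\<close>-th
  component of the change of charts.  Its coefficients matter only on \<open>overlap i j\<close>.\<close>

definition chart_change :: "'n::finite \<Rightarrow> 'n \<Rightarrow> 'n jet_poly \<Rightarrow> 'n jet_poly" where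
  "chart_change i j P =
     (\<Sum>m\<in>Poly_Mapping.keys P.
        coeff_poly (\<lambda>x. Poly_Mapping.lookup P m (transition i j x)) *
        (\<Prod>(t, l)\<in>Poly_Mapping.keys m.
            ((total_deriv i ^^ l) (coeff_poly (\<lambda>x. transition i j x $ t)))
              ^ Poly_Mapping.lookup m (t, l)))"

text \<open>The global sections of the direct sum over all weights of the Green-Griffiths bundles of
  jet order \<open>k\<close>, twisted by \<open>\<O>(d)\<close>.\<close>

definition GG_global_sections :: "nat \<Rightarrow> nat \<Rightarrow> ('n::finite \<Rightarrow> 'n jet_poly) set" where
  "GG_global_sections k d =
     {s. (\<forall>i. s i \<in> GG_sum_chart k i) \<and>
         (\<forall>i j m. \<forall>x\<in>overlap i j.
            Poly_Mapping.lookup (s i) m x =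
              (homog i x $ j) ^ d * Poly_Mapping.lookup (chart_change i j (s j)) m x)}"

definition scale_sections :: "complex \<Rightarrow> ('n::finite \<Rightarrow> 'n jet_poly) \<Rightarrow> 'n \<Rightarrow> 'n jet_poly" where
  "scale_sections c s = (\<lambda>i. coeff_poly (\<lambda>_. c) * s i)"

lemma coeff_poly_hom:
  "coeff_poly (\<lambda>_. a + b) = coeff_poly (\<lambda>_. a) + coeff_poly (\<lambda>_. b)"
  "coeff_poly (\<lambda>_. a * b) = coeff_poly (\<lambda>_. a) * coeff_poly (\<lambda>_. b)"
  "coeff_poly (\<lambda>_. 1) = 1"
proof -
  show "coeff_poly (\<lambda>_. a + b) = coeff_poly (\<lambda>_. a) + coeff_poly (\<lambda>_. b)"
    by (simp add: coeff_poly_def flip: single_add) (simp add: plus_fun_def)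
  show "coeff_poly (\<lambda>_. a * b) = coeff_poly (\<lambda>_. a) * coeff_poly (\<lambda>_. b)"
    by (simp add: coeff_poly_def mult_single) (simp add: times_fun_def)
  show "coeff_poly (\<lambda>_. 1) = 1"
    by (simp add: coeff_poly_def flip: single_one) (simp add: one_fun_def)
qed

interpretation jet_sections: vector_space
  "scale_sections :: complex \<Rightarrow> ('n::finite \<Rightarrow> 'n jet_poly) \<Rightarrow> 'n \<Rightarrow> 'n jet_poly"
  by unfold_locales
    (auto simp: scale_sections_def coeff_poly_hom fun_eq_iff algebra_simps)

lemma lookup_coeff_poly_mult:
  "Poly_Mapping.lookup (coeff_poly f * P) m = f * Poly_Mapping.lookup P m"
  by (simp add: coeff_poly_def flip: mult_map_scale_conv_mult) (simp add: Poly_Mapping.map.rep_eq when_def)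

lemma chart_function_zero: "chart_function i 0"
  by (auto simp: chart_function_def holomorphic_several_def zero_fun_def intro!: exI[of _ "\<lambda>_. 0"])

lemma chart_function_add:
  assumes "chart_function i f" "chart_function i g"
  shows "chart_function i (f + g)"
  unfolding chart_function_def holomorphic_several_def
proof (intro conjI ballI allI)
  fix x
  from assms obtain f' g' where
    "(f has_derivative f') (at x)" "\<forall>c v. f' (c *s v) = c * f' v"
    "(g has_derivative g') (at x)" "\<forall>c v. g' (c *s v) = c * g' v"
    unfolding chart_function_def holomorphic_several_def by blast
  then have "((f + g) has_derivative (\<lambda>v. f' v + g' v)) (at x) \<and>
      (\<forall>c v. f' (c *s v) + g' (c *s v) = c * (f' v + g' v))"
    by (auto simp: plus_fun_def distrib_left intro!: has_derivative_add)
  then show "\<exists>h. ((f + g) has_derivative h) (at x) \<and> (\<forall>c v. h (c *s v) = c * h v)"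
    by (intro exI[of _ "\<lambda>v. f' v + g' v"]) simp
next
  show "(f + g) (homog i x) = (f + g) x" for x
    using assms by (simp add: chart_function_def)
qed

lemma chart_function_scale:
  assumes "chart_function i f"
  shows "chart_function i ((\<lambda>_. a) * f)"
  unfolding chart_function_def holomorphic_several_def
proof (intro conjI ballI allI)
  fix x
  from assms obtain f' where
    "(f has_derivative f') (at x)" "\<forall>c v. f' (c *s v) = c * f' v"
    unfolding chart_function_def holomorphic_several_def by blast
  then have "(((\<lambda>_. a) * f) has_derivative (\<lambda>v. a * f' v)) (at x) \<and>
      (\<forall>c v. a * f' (c *s v) = c * (a * f' v))"
    by (auto simp: times_fun_def intro!: has_derivative_mult_right)
  then show "\<exists>h. (((\<lambda>_. a) * f) has_derivative h) (at x) \<and> (\<forall>c v. h (c *s v) = c * h v)"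
    by (intro exI[of _ "\<lambda>v. a * f' v"]) simp
next
  show "((\<lambda>_. a) * f) (homog i x) = ((\<lambda>_. a) * f) x" for x
    using assms by (simp add: chart_function_def)
qed

lemma GG_chart_zero: "0 \<in> GG_chart k n i"
  by (simp add: GG_chart_def)

lemma GG_chart_add:
  assumes "P \<in> GG_chart k n i" "Q \<in> GG_chart k n i"
  shows "P + Q \<in> GG_chart k n i"
proof -
  have cf: "chart_function i (Poly_Mapping.lookup R m)" if "R \<in> GG_chart k n i" for R m
    using that chart_function_zero by (cases "m \<in> Poly_Mapping.keys R")
      (auto simp: GG_chart_def in_keys_iff)
  have "chart_function i (Poly_Mapping.lookup (P + Q) m)" for m
    by (simp only: lookup_add chart_function_add cf[OF assms(1)] cf[OF assms(2)])
  moreover have "m \<in> Poly_Mapping.keys P \<union> Poly_Mapping.keys Q"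
    if "m \<in> Poly_Mapping.keys (P + Q)" for m
    by (rule subsetD[OF Poly_Mapping.keys_add that])
  ultimately show ?thesis
    using assms by (force simp: GG_chart_def)
qed

lemma GG_chart_scale:
  assumes "P \<in> GG_chart k n i"
  shows "coeff_poly (\<lambda>_. a) * P \<in> GG_chart k n i"
proof -
  have "m \<in> Poly_Mapping.keys P" if "m \<in> Poly_Mapping.keys (coeff_poly (\<lambda>_. a) * P)" for m
    using that by (auto simp: in_keys_iff lookup_coeff_poly_mult)
  then show ?thesis
    using assms unfolding GG_chart_def
    by (simp add: lookup_coeff_poly_mult chart_function_scale)
qed

lemma GG_sum_chart_zero: "0 \<in> GG_sum_chart k i"
  unfolding GG_sum_chart_def by (auto intro!: exI[of _ 0])

lemma GG_sum_chart_add: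
  assumes "P \<in> GG_sum_chart k i" "Q \<in> GG_sum_chart k i"
  shows "P + Q \<in> GG_sum_chart k i"
proof -
  obtain M p where p: "P = (\<Sum>n<M. p n)" "\<forall>n<M. p n \<in> GG_chart k n i"
    using assms(1) unfolding GG_sum_chart_def by blast
  obtain L q where q: "Q = (\<Sum>n<L. q n)" "\<forall>n<L. q n \<in> GG_chart k n i"
    using assms(2) unfolding GG_sum_chart_def by blast
  have P: "P = (\<Sum>n<max M L. if n < M then p n else 0)"
    unfolding p by (rule sum.mono_neutral_cong_left) auto
  have Q: "Q = (\<Sum>n<max M L. if n < L then q n else 0)"
    unfolding q by (rule sum.mono_neutral_cong_left) auto
  have "P + Q = (\<Sum>n<max M L. (if n < M then p n else 0) + (if n < L then q n else 0))"
    by (subst P, subst Q) (simp only: sum.distrib)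
  moreover have "\<forall>n<max M L. (if n < M then p n else 0) + (if n < L then q n else 0) \<in> GG_chart k n i"
    using p q by (auto intro!: GG_chart_add simp: GG_chart_zero)
  ultimately show ?thesis
    unfolding GG_sum_chart_def mem_Collect_eq by (intro exI conjI)
qed

lemma GG_sum_chart_scale:
  assumes "P \<in> GG_sum_chart k i"
  shows "coeff_poly (\<lambda>_. a) * P \<in> GG_sum_chart k i"
proof -
  obtain M p where p: "P = (\<Sum>n<M. p n)" "\<forall>n<M. p n \<in> GG_chart k n i"
    using assms unfolding GG_sum_chart_def by blast
  have "coeff_poly (\<lambda>_. a) * P = (\<Sum>n<M. coeff_poly (\<lambda>_. a) * p n)"
    unfolding p by (rule sum_distrib_left)
  moreover have "\<forall>n<M. coeff_poly (\<lambda>_. a) * p n \<in> GG_chart k n i"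
    using p GG_chart_scale by blast
  ultimately show ?thesis
    unfolding GG_sum_chart_def mem_Collect_eq by (intro exI conjI)
qed

lemma chart_change_superset:
  assumes "finite A" "Poly_Mapping.keys P \<subseteq> A"
  shows "chart_change i j P =
     (\<Sum>m\<in>A. coeff_poly (\<lambda>x. Poly_Mapping.lookup P m (transition i j x)) *
        (\<Prod>(t, l)\<in>Poly_Mapping.keys m.
            ((total_deriv i ^^ l) (coeff_poly (\<lambda>x. transition i j x $ t)))
              ^ Poly_Mapping.lookup m (t, l)))"
  unfolding chart_change_def
proof (rule sum.mono_neutral_left, goal_cases)
  case 3
  have "coeff_poly (\<lambda>x. Poly_Mapping.lookup P m (transition i j x)) = 0"
    if "m \<notin> Poly_Mapping.keys P" for m
  proof -
    have "(\<lambda>x. Poly_Mapping.lookup P m (transition i j x)) = 0"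
      using that by (simp add: in_keys_iff zero_fun_def)
    then show ?thesis by (simp add: coeff_poly_def)
  qed
  then show ?case by simp
qed (use assms in auto)

lemma chart_change_zero: "chart_change i j 0 = 0"
  by (simp add: chart_change_def)

lemma chart_change_add: "chart_change i j (P + Q) = chart_change i j P + chart_change i j Q"
proof -
  let ?A = "Poly_Mapping.keys P \<union> Poly_Mapping.keys Q"
  have c: "coeff_poly (\<lambda>x. Poly_Mapping.lookup (P + Q) m (transition i j x)) =
      coeff_poly (\<lambda>x. Poly_Mapping.lookup P m (transition i j x)) +
      coeff_poly (\<lambda>x. Poly_Mapping.lookup Q m (transition i j x))" for m
    by (simp add: coeff_poly_def lookup_add flip: single_add) (simp add: plus_fun_def)
  have "Poly_Mapping.keys (P + Q) \<subseteq> ?A" by (rule Poly_Mapping.keys_add)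
  then show ?thesis
    by (simp add: chart_change_superset[of ?A] c distrib_right sum.distrib)
qed

lemma chart_change_scale:
  "chart_change i j (coeff_poly (\<lambda>_. a) * P) = coeff_poly (\<lambda>_. a) * chart_change i j P"
proof -
  have c: "coeff_poly (\<lambda>x. Poly_Mapping.lookup (coeff_poly (\<lambda>_. a) * P) m (transition i j x)) =
      coeff_poly (\<lambda>_. a) * coeff_poly (\<lambda>x. Poly_Mapping.lookup P m (transition i j x))" for m
    by (simp only: lookup_coeff_poly_mult) (simp add: coeff_poly_def mult_single times_fun_def)
  have "Poly_Mapping.keys (coeff_poly (\<lambda>_. a) * P) \<subseteq> Poly_Mapping.keys P"
    by (auto simp: in_keys_iff lookup_coeff_poly_mult)
  then show ?thesis
    by (simp add: chart_change_superset[of "Poly_Mapping.keys P"] c sum_distrib_left mult.assoc)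
qed

lemma GG_global_sections_subspace:
  "jet_sections.subspace (GG_global_sections k d :: ('n::finite \<Rightarrow> 'n jet_poly) set)"
proof (rule jet_sections.subspaceI)
  show "(0 :: 'n \<Rightarrow> 'n jet_poly) \<in> GG_global_sections k d"
    by (simp add: GG_global_sections_def GG_sum_chart_zero chart_change_zero)
next
  fix s r :: "'n \<Rightarrow> 'n jet_poly"
  assume "s \<in> GG_global_sections k d" "r \<in> GG_global_sections k d"
  then show "s + r \<in> GG_global_sections k d"
    by (simp add: GG_global_sections_def GG_sum_chart_add chart_change_add lookup_add distrib_left)
next
  fix a and s :: "'n \<Rightarrow> 'n jet_poly"
  assume "s \<in> GG_global_sections k d"
  then show "scale_sections a s \<in> GG_global_sections k d"
    by (simp add: GG_global_sections_def scale_sections_def GG_sum_chart_scale chart_change_scale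
        lookup_coeff_poly_mult mult.left_commute)
qed

lemma total_deriv_coeff_poly:
  "total_deriv i (coeff_poly f) = (\<Sum>t\<in>- {i}. coeff_poly (partial_deriv t f) * jet_var t 1)"
proof (cases "f = 0")
  case True
  then have "partial_deriv t f = 0" for t
    by (simp add: partial_deriv_def fun_eq_iff)
  with True show ?thesis by (simp add: total_deriv_def coeff_poly_def)
next
  case False
  then show ?thesis by (simp add: total_deriv_def coeff_poly_def)
qed

lemma total_deriv_jet_var: "total_deriv i (jet_var t l) = jet_var t (Suc l)"
proof -
  have "partial_deriv t 1 = 0" for t :: 'a
    by (simp add: partial_deriv_def fun_eq_iff)
  then show ?thesis
    by (simp add: total_deriv_def jet_var_def mult_single) (simp add: one_fun_def times_fun_def)
qed

end

(*
  A section of the twisted bundle is a polynomial P in the Taylor coefficients of a curve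
  X = (X_0, ..., X_N) of power series with P(c X) = c(0)^d P(X) for every unit c.  The
  polynomiality of the coefficients follows from Liouville's theorem, because passing to
  another chart bounds their growth in each coordinate, and the pole along X_i = 0 is
  absent because it is not visible in the chart U_j.

  A basis of these covariant polynomials is indexed by the words of length d in the
  coordinates.  Multiplying X by c multiplies the d x d matrix, whose rows are the first d
  Taylor coefficients of series z^a X_t, by an upper triangular Toeplitz matrix with
  diagonal c(0), so every such determinant is covariant; the shift a of a letter is the
  number of earlier letters that are not larger.  Substitute z X_u for X_u for all u < t.
  The determinant of a word with first letter t becomes X_t(0) times the determinant of
  the rest of the word, and it becomes 0 if the first letter is smaller than t.  A general
  covariant P of degree d >= 1 vanishes after all coordinates have been substituted; if it
  vanishes after substituting those up to t, then substituting those below t makes it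
  X_t(0) times a covariant of degree d - 1.  Induction on d gives independence and spanning.
*)

theory Submission
  imports Defs "HOL-Complex_Analysis.Cauchy_Integral_Formula" "Jordan_Normal_Form.Determinant"
begin

section \<open>Polynomial functionals of curves\<close>

text \<open>Jet polynomials are compared through their values. A point of the chart U_i together
  with values of its jet variables is the same as a curve with X_i = 1, so a section becomes a
  function of normalised curves, and the change to U_j divides the curve by X_j. The cocycle of O(d)
  is then exactly covariance under the unit 1 / X_j, and formal differentiation is needed only to
  justify this translation.

  Since \<open>polyfun\<close> consists of functions instead of formal polynomials, substitution is
  composition. In return, cancelling or splitting off the variable X_t(0) needs proof: identities
  are first obtained where X_t(0) is nonzero and then extended by continuity in this one
  coefficient.

  The bound k >= d - 1 enters because the determinant of a word of length d reads the Taylor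
  coefficients of index 0 to d - 1. The argument against a pole along X_i = 0 compares two different
  charts, which N >= 1 provides.\<close>

inductive_set polyfun :: "nat \<Rightarrow> (('n \<Rightarrow> complex fps) \<Rightarrow> complex) set" for k where
  polyfun_const: "(\<lambda>X. c) \<in> polyfun k"
| polyfun_var: "l \<le> k \<Longrightarrow> (\<lambda>X. fps_nth (X t) l) \<in> polyfun k"
| polyfun_add: "P \<in> polyfun k \<Longrightarrow> Q \<in> polyfun k \<Longrightarrow> (\<lambda>X. P X + Q X) \<in> polyfun k"
| polyfun_mult: "P \<in> polyfun k \<Longrightarrow> Q \<in> polyfun k \<Longrightarrow> (\<lambda>X. P X * Q X) \<in> polyfun k"

lemma polyfun_diff:
  assumes "P \<in> polyfun k" "Q \<in> polyfun k"
  shows "(\<lambda>X. P X - Q X) \<in> polyfun k"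
  using polyfun_add[OF assms(1) polyfun_mult[OF polyfun_const[of "-1"] assms(2)]] by simp

lemma polyfun_sum:
  "finite A \<Longrightarrow> (\<And>a. a \<in> A \<Longrightarrow> P a \<in> polyfun k) \<Longrightarrow> (\<lambda>X. \<Sum>a\<in>A. P a X) \<in> polyfun k"
  by (induction A rule: finite_induct) (auto intro: polyfun_const polyfun_add)

lemma polyfun_prod:
  "finite A \<Longrightarrow> (\<And>a. a \<in> A \<Longrightarrow> P a \<in> polyfun k) \<Longrightarrow> (\<lambda>X. \<Prod>a\<in>A. P a X) \<in> polyfun k"
  by (induction A rule: finite_induct) (auto intro: polyfun_const polyfun_mult)

lemma polyfun_power: "P \<in> polyfun k \<Longrightarrow> (\<lambda>X. P X ^ m) \<in> polyfun k"
  by (induction m) (auto intro: polyfun_const polyfun_mult)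

lemma polyfun_subst:
  assumes "P \<in> polyfun k" "\<And>t l. l \<le> k \<Longrightarrow> (\<lambda>X. fps_nth (T X t) l) \<in> polyfun k'"
  shows "(\<lambda>X. P (T X)) \<in> polyfun k'"
  using assms(1) by induction (auto intro: assms(2) polyfun.intros)

lemma polyfun_scale:
  assumes "P \<in> polyfun k" shows "(\<lambda>X. P (\<lambda>t. c * X t)) \<in> polyfun k"
  by (rule polyfun_subst[OF assms])
    (auto simp: fps_mult_nth intro!: polyfun_sum polyfun_mult polyfun_const polyfun_var)

lemma polyfun_continuous:
  assumes "P \<in> polyfun k" "\<And>t l. continuous_on S (\<lambda>z. fps_nth (X z t) l)"
  shows "continuous_on S (\<lambda>z. P (X z))"
  using assms(1) by induction (auto intro!: continuous_intros assms(2))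

definition set_coeff0 :: "'n \<Rightarrow> complex \<Rightarrow> ('n \<Rightarrow> complex fps) \<Rightarrow> 'n \<Rightarrow> complex fps" where
  "set_coeff0 t z X = X(t := X t + fps_const (z - fps_nth (X t) 0))"

lemma nth_set_coeff0:
  "fps_nth (set_coeff0 t z X u) l = (if u = t \<and> l = 0 then z else fps_nth (X u) l)"
  by (auto simp: set_coeff0_def)

lemma set_coeff0_ident: "set_coeff0 t (fps_nth (X t) 0) X = X"
  by (simp add: fun_eq_iff fps_eq_iff nth_set_coeff0)

lemma polyfun_set_coeff0:
  assumes "P \<in> polyfun k" shows "(\<lambda>X. P (set_coeff0 t 0 X)) \<in> polyfun k"
proof (rule polyfun_subst[OF assms])
  show "(\<lambda>X. fps_nth (set_coeff0 t 0 X u) l) \<in> polyfun k" if "l \<le> k" for u l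
    using that by (cases "u = t \<and> l = 0") (auto simp: nth_set_coeff0 intro: polyfun.intros)
qed

lemma continuous_eq_at_zero:
  fixes f g :: "complex \<Rightarrow> complex"
  assumes "continuous_on UNIV f" "continuous_on UNIV g" "\<And>z. z \<noteq> 0 \<Longrightarrow> f z = g z"
  shows "f 0 = g 0"
proof -
  have "(f \<longlongrightarrow> f 0) (at 0)" "(g \<longlongrightarrow> g 0) (at 0)"
    using assms(1,2) by (auto simp: continuous_on_eq_continuous_at isCont_def)
  moreover have "(f \<longlongrightarrow> g 0) (at 0)"
    using \<open>(g \<longlongrightarrow> g 0) (at 0)\<close>
    by (rule Lim_transform_eventually) (simp add: eventually_at_filter assms(3))
  ultimately show ?thesis
    using tendsto_unique trivial_limit_at by blast
qed

text \<open>With all other Taylor coefficients fixed, both sides are continuous in the constant term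
  of \<open>X t\<close>, so letting it tend to 0 covers the excluded hyperplane.\<close>

lemma polyfun_eqI:
  assumes "P \<in> polyfun k" "Q \<in> polyfun k" "\<And>X. fps_nth (X t) 0 \<noteq> 0 \<Longrightarrow> P X = Q X"
  shows "P X = Q X"
proof (cases "fps_nth (X t) 0 = 0")
  case True
  have c: "continuous_on UNIV (\<lambda>z. fps_nth (set_coeff0 t z X u) l)" for u l
    by (cases "u = t"; cases "l = 0") (simp_all add: nth_set_coeff0)
  have "P (set_coeff0 t 0 X) = Q (set_coeff0 t 0 X)"
    by (rule continuous_eq_at_zero[of "\<lambda>z. P (set_coeff0 t z X)" "\<lambda>z. Q (set_coeff0 t z X)"])
      (auto intro!: polyfun_continuous[OF assms(1)] polyfun_continuous[OF assms(2)] c assms(3) simp: nth_set_coeff0)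
  then show ?thesis using True set_coeff0_ident[of t X] by simp
qed (rule assms(3))

lemma polyfun_cancel:
  assumes "P \<in> polyfun k" "Q \<in> polyfun k"
    "\<And>X. fps_nth (X t) 0 ^ m * P X = fps_nth (X t) 0 ^ m * Q X"
  shows "P X = Q X"
proof (rule polyfun_eqI[OF assms(1,2)])
  show "P X = Q X" if "fps_nth (X t) 0 \<noteq> 0" for X
    using assms(3)[of X] that by simp
qed

text \<open>This is division with remainder by the variable \<open>fps_nth (X t) 0\<close>; the
  remainder is \<open>P\<close> with that variable set to 0.\<close>

lemma polyfun_divide:
  assumes "P \<in> polyfun k"
  shows "\<exists>Q\<in>polyfun k. \<forall>X. P X = P (set_coeff0 t 0 X) + fps_nth (X t) 0 * Q X"
  using assms
proof induction
  case (polyfun_const c)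
  show ?case by (rule bexI[OF _ polyfun.polyfun_const[of 0]]) simp
next
  case (polyfun_var l u)
  show ?case
  proof (cases "u = t \<and> l = 0")
    case True
    then show ?thesis
      by (intro bexI[OF _ polyfun.polyfun_const[of 1]]) (auto simp: nth_set_coeff0)
  next
    case False
    then show ?thesis
      by (intro bexI[OF _ polyfun.polyfun_const[of 0]]) (auto simp: nth_set_coeff0)
  qed
next
  case (polyfun_add P Q)
  then obtain P' Q' where *:
    "P' \<in> polyfun k" "\<And>X. P X = P (set_coeff0 t 0 X) + fps_nth (X t) 0 * P' X"
    "Q' \<in> polyfun k" "\<And>X. Q X = Q (set_coeff0 t 0 X) + fps_nth (X t) 0 * Q' X"
    by metis
  have "P X + Q X = P (set_coeff0 t 0 X) + Q (set_coeff0 t 0 X) + fps_nth (X t) 0 * (P' X + Q' X)" for X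
    by (subst *(2), subst *(4)) (simp add: algebra_simps)
  then show ?case by (intro bexI[OF allI polyfun.polyfun_add[OF *(1,3)]])
next
  case (polyfun_mult P Q)
  then obtain P' Q' where *:
    "P' \<in> polyfun k" "\<And>X. P X = P (set_coeff0 t 0 X) + fps_nth (X t) 0 * P' X"
    "Q' \<in> polyfun k" "\<And>X. Q X = Q (set_coeff0 t 0 X) + fps_nth (X t) 0 * Q' X"
    by metis
  \<comment> \<open>The quotient comes from writing P Q - P0 Q0 as (P - P0) Q + P0 (Q - Q0), where
    the index 0 marks the substituted functions.\<close>
  let ?R = "\<lambda>X. P' X * Q X + P (set_coeff0 t 0 X) * Q' X"
  have R: "?R \<in> polyfun k"
    by (intro polyfun.polyfun_add polyfun.polyfun_mult polyfun_mult(2) *(1,3)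
        polyfun_set_coeff0[OF polyfun_mult(1)])
  have PQ: "P X * Q X = P (set_coeff0 t 0 X) * Q (set_coeff0 t 0 X) + fps_nth (X t) 0 * ?R X" for X
  proof -
    have "P X * Q X - P (set_coeff0 t 0 X) * Q (set_coeff0 t 0 X) =
        (P X - P (set_coeff0 t 0 X)) * Q X + P (set_coeff0 t 0 X) * (Q X - Q (set_coeff0 t 0 X))"
      by (simp add: algebra_simps)
    also have "P X - P (set_coeff0 t 0 X) = fps_nth (X t) 0 * P' X" by (subst *(2)) simp
    also have "Q X - Q (set_coeff0 t 0 X) = fps_nth (X t) 0 * Q' X" by (subst *(4)) simp
    finally show ?thesis by (simp add: algebra_simps)
  qed
  show ?case by (intro bexI[OF allI R]) (rule PQ)
qed

lemma polyfun_divideE: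
  assumes "P \<in> polyfun k" "\<And>X. fps_nth (X t) 0 = 0 \<Longrightarrow> P X = 0"
  obtains Q where "Q \<in> polyfun k" "\<And>X. P X = fps_nth (X t) 0 * Q X"
proof -
  obtain Q where "Q \<in> polyfun k" "\<forall>X. P X = P (set_coeff0 t 0 X) + fps_nth (X t) 0 * Q X"
    using polyfun_divide[OF assms(1)] by blast
  moreover have "P (set_coeff0 t 0 X) = 0" for X
    by (rule assms(2)) (simp add: nth_set_coeff0)
  ultimately show ?thesis using that by simp
qed

section \<open>Covariant functionals\<close>

text \<open>Two lifts of one projective curve to homogeneous coordinates differ by a unit
  \<open>c\<close>; the functionals collected here have degree \<open>d\<close> under that
  change.\<close>

definition covariant :: "nat \<Rightarrow> nat \<Rightarrow> (('n \<Rightarrow> complex fps) \<Rightarrow> complex) set" where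
  "covariant k d = {P \<in> polyfun k.
     \<forall>c X. fps_nth c 0 \<noteq> 0 \<longrightarrow> P (\<lambda>t. c * X t) = fps_nth c 0 ^ d * P X}"

text \<open>The series z + \<open>fps_X\<close> is a unit for every z other than 0; let z tend to 0.
  Writing \<open>0 ^ d\<close> keeps degree 0 correct as well, where the factor is 1.\<close>

lemma covariant_vanish:
  assumes "P \<in> covariant k d"
  shows "P (\<lambda>t. fps_X * X t) = 0 ^ d * P X"
proof -
  have P: "P \<in> polyfun k" using assms by (simp add: covariant_def)
  have "P (\<lambda>t. (fps_const 0 + fps_X) * X t) = 0 ^ d * P X"
  proof (rule continuous_eq_at_zero[of "\<lambda>z. P (\<lambda>t. (fps_const z + fps_X) * X t)" "\<lambda>z. z ^ d * P X"])
    show "continuous_on UNIV (\<lambda>z. P (\<lambda>t. (fps_const z + fps_X) * X t))"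
      by (rule polyfun_continuous[OF P])
        (auto simp: distrib_right fps_X_mult_nth intro!: continuous_intros)
    show "P (\<lambda>t. (fps_const z + fps_X) * X t) = z ^ d * P X" if "z \<noteq> 0" for z
      using assms that by (simp add: covariant_def)
  qed (auto intro!: continuous_intros)
  then show ?thesis by simp
qed

lemma covariant_0_const:
  assumes "P \<in> covariant k 0"
  shows "P X = P (\<lambda>_. 0)"
proof -
  have P: "P \<in> polyfun k" using assms by (simp add: covariant_def)
  have "P (\<lambda>t. fps_const 0 * X t) = P X"
  proof (rule continuous_eq_at_zero[of "\<lambda>z. P (\<lambda>t. fps_const z * X t)" "\<lambda>z. P X"])
    show "continuous_on UNIV (\<lambda>z. P (\<lambda>t. fps_const z * X t))"
      by (rule polyfun_continuous[OF P]) (auto intro!: continuous_intros)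
    show "P (\<lambda>t. fps_const z * X t) = P X" if "z \<noteq> 0" for z
      using assms that by (simp add: covariant_def)
  qed auto
  then show ?thesis by simp
qed

section \<open>Determinants attached to words\<close>

text \<open>An arbitrary linear order on the coordinates.\<close>

definition coord_rank :: "'n::finite \<Rightarrow> nat" where
  "coord_rank = (SOME f. bij_betw f UNIV {..<CARD('n)})"

lemma coord_rank_bij: "bij_betw (coord_rank :: 'n::finite \<Rightarrow> nat) UNIV {..<CARD('n)}"
proof -
  have "\<exists>f :: 'n \<Rightarrow> nat. bij_betw f UNIV {..<CARD('n)}"
    by (metis atLeast0LessThan ex_bij_betw_finite_nat finite)
  then show ?thesis unfolding coord_rank_def by (rule someI_ex)
qed

lemma coord_rank_less: "coord_rank (t :: 'n::finite) < CARD('n)"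
  using coord_rank_bij[where 'n = 'n] by (auto simp: bij_betw_def)

lemma coord_rank_eq_iff [simp]: "coord_rank t = coord_rank u \<longleftrightarrow> t = u"
  using coord_rank_bij by (metis bij_betw_def inj_eq)

lemma coord_rank_obtain:
  assumes "q < CARD('n)" obtains t :: "'n::finite" where "coord_rank t = q"
  using coord_rank_bij[where 'n = 'n] assms unfolding bij_betw_def by (metis imageE lessThan_iff)

text \<open>Putting a letter a in front raises the shift of a later letter u by one if a is not
  larger than u, while \<open>delay (coord_rank a)\<close> multiplies \<open>X u\<close> by
  \<open>fps_X\<close> if u is smaller than a. Exactly one of the two happens, so every later row
  gains exactly one factor \<open>fps_X\<close>. This balance dictates the choice of shifts.\<close>

definition shift :: "'n::finite list \<Rightarrow> nat \<Rightarrow> nat" where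
  "shift w r = card {s. s < r \<and> coord_rank (w ! s) \<le> coord_rank (w ! r)}"

definition word_mat :: "'n::finite list \<Rightarrow> ('n \<Rightarrow> complex fps) \<Rightarrow> complex mat" where
  "word_mat w X = mat (length w) (length w) (\<lambda>(r, c). fps_nth (fps_X ^ shift w r * X (w ! r)) c)"

definition word_poly :: "'n::finite list \<Rightarrow> ('n \<Rightarrow> complex fps) \<Rightarrow> complex" where
  "word_poly w X = Determinant.det (word_mat w X)"

text \<open>The substitution of the overview, in steps: q = 0 leaves the curve alone, and q =
  \<open>CARD('n)\<close> multiplies all of it by \<open>fps_X\<close>.\<close>

definition delay :: "nat \<Rightarrow> ('n::finite \<Rightarrow> complex fps) \<Rightarrow> 'n \<Rightarrow> complex fps" where
  "delay q X t = (if coord_rank t < q then fps_X * X t else X t)"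

lemma word_poly_polyfun:
  assumes "length w \<le> Suc k" shows "word_poly w \<in> polyfun k"
proof -
  let ?n = "length w"
  have e: "(\<lambda>X. word_mat w X $$ (r, c)) \<in> polyfun k" if "r < ?n" "c < ?n" for r c
    using that assms by (cases "c < shift w r") (auto simp: word_mat_def fps_X_power_mult_nth intro: polyfun.intros)
  have "word_poly w = (\<lambda>X. \<Sum>p\<in>{p. p permutes {0..<?n}}. signof p * (\<Prod>r = 0..<?n. word_mat w X $$ (r, p r)))"
    by (simp add: fun_eq_iff word_poly_def det_def'[of _ ?n] word_mat_def)
  also have "\<dots> \<in> polyfun k"
    using permutes_in_image[of _ "{0..<?n}"]
    by (intro polyfun_sum polyfun_mult polyfun_const polyfun_prod e) (auto simp: finite_permutations)
  finally show ?thesis .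
qed

lemma word_poly_covariant:
  assumes "length w \<le> Suc k" shows "word_poly w \<in> covariant k (length w)"
proof -
  let ?n = "length w"
  have "word_poly w (\<lambda>t. c * X t) = fps_nth c 0 ^ ?n * word_poly w X" for c X
  proof -
    define U where "U = mat ?n ?n (\<lambda>(a, b). if a \<le> b then fps_nth c (b - a) else 0)"
    have U: "U \<in> carrier_mat ?n ?n" by (simp add: U_def)
    have M: "word_mat w X \<in> carrier_mat ?n ?n" by (simp add: word_mat_def)
    have "word_mat w (\<lambda>t. c * X t) = word_mat w X * U"
    proof (rule eq_matI)
      fix r b assume "r < dim_row (word_mat w X * U)" "b < dim_col (word_mat w X * U)"
      then have rb: "r < ?n" "b < ?n" by (simp_all add: word_mat_def U_def)
      let ?f = "fps_X ^ shift w r * X (w ! r)"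
      have "(word_mat w X * U) $$ (r, b) = (\<Sum>a = 0..<?n. fps_nth ?f a * (if a \<le> b then fps_nth c (b - a) else 0))"
        using rb by (simp add: word_mat_def U_def scalar_prod_def)
      also have "\<dots> = (\<Sum>a = 0..b. fps_nth ?f a * fps_nth c (b - a))"
        using rb by (intro sum.mono_neutral_cong_right) auto
      also have "\<dots> = fps_nth (?f * c) b" by (simp add: fps_mult_nth)
      finally show "word_mat w (\<lambda>t. c * X t) $$ (r, b) = (word_mat w X * U) $$ (r, b)"
        using rb by (simp add: word_mat_def mult_ac)
    qed (simp_all add: word_mat_def U_def)
    moreover have "Determinant.det U = fps_nth c 0 ^ ?n"
    proof -
      have "Determinant.det U = prod_list (diag_mat U)"
        by (rule det_upper_triangular[OF _ U]) (auto simp: U_def)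
      also have "\<dots> = (\<Prod>a = 0..<?n. fps_nth c 0)"
        unfolding prod_list_diag_prod by (simp add: U_def)
      finally show ?thesis by simp
    qed
    ultimately show ?thesis
      by (simp add: word_poly_def det_mult[OF M U])
  qed
  then show ?thesis using word_poly_polyfun[OF assms] by (simp add: covariant_def)
qed

lemma shift_Cons:
  "shift (a # w) (Suc r) = (if coord_rank a \<le> coord_rank (w ! r) then 1 else 0) + shift w r"
proof -
  let ?A = "{s. s < r \<and> coord_rank (w ! s) \<le> coord_rank (w ! r)}"
  have "{s. s < Suc r \<and> coord_rank ((a # w) ! s) \<le> coord_rank (w ! r)} =
      (if coord_rank a \<le> coord_rank (w ! r) then {0} else {}) \<union> Suc ` ?A"
    (is "?L = ?R")
  proof (rule Set.set_eqI)
    show "s \<in> ?L \<longleftrightarrow> s \<in> ?R" for s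
      by (cases s) auto
  qed
  moreover have "finite ?A" by simp
  ultimately show ?thesis
    unfolding shift_def nth_Cons_Suc by (auto simp: card_image)
qed

text \<open>A row below the first has constant term 0: its letter is either at least
  \<open>a\<close>, and then its shift is positive, or smaller than \<open>a\<close>, and then it is
  delayed. The first row has shift 0 and survives unless \<open>a\<close> itself is delayed.\<close>

lemma word_mat_col0_delay:
  assumes "r < length (a # w)" "q \<ge> coord_rank a"
  shows "word_mat (a # w) (delay q X) $$ (r, 0) = (if r = 0 \<and> q = coord_rank a then fps_nth (X a) 0 else 0)"
proof (cases r)
  case 0
  then show ?thesis using assms by (auto simp: word_mat_def delay_def shift_def)
next
  case (Suc s)
  then show ?thesis using assms
    by (auto simp: word_mat_def delay_def shift_Cons fps_X_power_mult_nth)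
qed

lemma word_poly_delay_eq_0:
  assumes "q > coord_rank a"
  shows "word_poly (a # w) (delay q X) = 0"
proof -
  let ?M = "word_mat (a # w) (delay q X)"
  have "?M \<in> carrier_mat (length (a # w)) (length (a # w))" by (simp add: word_mat_def)
  then have "Determinant.det ?M = (\<Sum>i<length (a # w). ?M $$ (i, 0) * cofactor ?M i 0)"
    by (rule laplace_expansion_column) simp
  also have "\<dots> = 0"
    using assms by (intro sum.neutral ballI) (simp only: word_mat_col0_delay lessThan_iff less_imp_le, auto)
  finally show ?thesis by (simp add: word_poly_def)
qed

lemma word_poly_delay_Cons:
  "word_poly (a # w) (delay (coord_rank a) X) = fps_nth (X a) 0 * word_poly w X"
proof -
  let ?M = "word_mat (a # w) (delay (coord_rank a) X)"
  have M: "?M \<in> carrier_mat (length (a # w)) (length (a # w))" by (simp add: word_mat_def)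
  then have "Determinant.det ?M = (\<Sum>i<length (a # w). ?M $$ (i, 0) * cofactor ?M i 0)"
    by (rule laplace_expansion_column) simp
  also have "\<dots> = (\<Sum>i<length (a # w). if i = 0 then fps_nth (X a) 0 * cofactor ?M 0 0 else 0)"
    by (intro sum.cong refl) (simp only: word_mat_col0_delay lessThan_iff order_refl, auto)
  also have "\<dots> = fps_nth (X a) 0 * cofactor ?M 0 0" by (simp add: sum.delta)
  also have "cofactor ?M 0 0 = Determinant.det (mat_delete ?M 0 0)" by (simp add: cofactor_def)
  \<comment> \<open>The one extra factor \<open>fps_X\<close> in each remaining row moves its
    coefficients one column to the right, and deleting column 0 undoes this.\<close>
  also have "mat_delete ?M 0 0 = word_mat w X"
  proof (rule eq_matI)
    fix r c assume "r < dim_row (word_mat w X)" "c < dim_col (word_mat w X)"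
    then have rc: "r < length w" "c < length w" by (simp_all add: word_mat_def)
    then have "mat_delete ?M 0 0 $$ (r, c) = ?M $$ (Suc r, Suc c)"
      by (simp add: mat_delete_def word_mat_def)
    also have "\<dots> = word_mat w X $$ (r, c)"
      using rc by (auto simp: word_mat_def shift_Cons fps_X_power_mult_nth delay_def Suc_diff_le)
    finally show "mat_delete ?M 0 0 $$ (r, c) = word_mat w X $$ (r, c)" .
  qed (simp_all add: word_mat_def mat_delete_def)
  finally show ?thesis by (simp add: word_poly_def)
qed

lemma polyfun_delay:
  assumes "P \<in> polyfun k" shows "(\<lambda>X. P (delay q X)) \<in> polyfun k"
proof (rule polyfun_subst[OF assms])
  show "(\<lambda>X. fps_nth (delay q X t) l) \<in> polyfun k" if "l \<le> k" for t l
    using that by (cases "coord_rank t < q"; cases l) (auto simp: delay_def fps_X_mult_nth intro: polyfun.intros)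
qed

section \<open>Spanning and independence of the word determinants\<close>

definition words :: "nat \<Rightarrow> 'n list set" where
  "words d = {w. length w = d}"

lemma finite_words: "finite (words d :: 'n::finite list set)"
  using finite_lists_length_eq[of "UNIV :: 'n set" d] by (simp add: words_def)

lemma card_words: "card (words d :: 'n::finite list set) = CARD('n) ^ d"
  using card_lists_length_eq[of "UNIV :: 'n set" d] by (simp add: words_def)

lemma words_Suc: "words (Suc d) = (\<lambda>(a, w). a # w) ` (UNIV \<times> words d)"
  by (auto simp: words_def length_Suc_conv)

lemma sum_words_Suc:
  "(\<Sum>w\<in>words (Suc d). f w) = (\<Sum>a\<in>UNIV. \<Sum>w\<in>words d. f (a # w))" for f :: "'n::finite list \<Rightarrow> complex"
proof -
  have "inj_on (\<lambda>(a, w). a # w) (UNIV \<times> words d :: ('n \<times> 'n list) set)"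
    by (auto simp: inj_on_def)
  then show ?thesis
    by (simp add: words_Suc sum.reindex sum.cartesian_product case_prod_unfold)
qed

text \<open>Passing from \<open>Suc q\<close> to \<open>q\<close>, a combination \<open>S\<close> of
  words with first letter \<open>t\<close> is subtracted so that the difference already vanishes
  after \<open>delay q\<close>. The bound \<open>d \<le> k\<close> puts the determinants of length
  \<open>Suc d\<close> within jet order \<open>k\<close>.\<close>

lemma covariant_span_delay:
  fixes P :: "('n::finite \<Rightarrow> complex fps) \<Rightarrow> complex"
  assumes IH: "\<And>Q :: ('n \<Rightarrow> complex fps) \<Rightarrow> complex. Q \<in> covariant k d \<Longrightarrow> \<exists>c. \<forall>X. Q X = (\<Sum>w\<in>words d. c w * word_poly w X)"
    and d: "d \<le> k"
  shows "P \<in> covariant k (Suc d) \<Longrightarrow> \<forall>X. P (delay q X) = 0 \<Longrightarrow> q \<le> CARD('n) \<Longrightarrow>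
    \<exists>c. \<forall>X. P X = (\<Sum>w\<in>words (Suc d). c w * word_poly w X)"
proof (induction q arbitrary: P)
  case 0
  \<comment> \<open>Here \<open>delay 0\<close> is the identity, so \<open>P\<close> itself is
    zero.\<close>
  then show ?case by (intro exI[of _ "\<lambda>_. 0"]) (simp add: delay_def cong: if_cong)
next
  case (Suc q)
  then obtain t :: 'n where t: "coord_rank t = q" by (meson Suc_le_lessD coord_rank_obtain)
  have P: "P \<in> polyfun k" using Suc.prems by (simp add: covariant_def)
  \<comment> \<open>If \<open>X t\<close> has no constant term, it is \<open>fps_X\<close> times a
    series, so \<open>delay q X\<close> also arises by \<open>delay (Suc q)\<close> from another
    curve.\<close>
  have "P (delay q X) = 0" if "fps_nth (X t) 0 = 0" for X
  proof -
    have "X t = fps_X * fps_shift 1 (X t)"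
      using that by (simp add: fps_eq_iff fps_X_mult_nth)
    then have "delay q X = delay (Suc q) (X(t := fps_shift 1 (X t)))"
      using t by (auto simp: delay_def fun_eq_iff less_Suc_eq)
    then show ?thesis using Suc.prems(2) by simp
  qed
  then obtain Q where Q: "Q \<in> polyfun k" and PQ: "\<And>X. P (delay q X) = fps_nth (X t) 0 * Q X"
    using polyfun_divideE[OF polyfun_delay[OF P]] by metis
  have "Q \<in> covariant k d"
    unfolding covariant_def mem_Collect_eq
  proof (intro conjI Q allI impI)
    fix c :: "complex fps" and X :: "'n \<Rightarrow> complex fps" assume c: "fps_nth c 0 \<noteq> 0"
    show "Q (\<lambda>u. c * X u) = fps_nth c 0 ^ d * Q X"
    proof (rule polyfun_eqI[of "\<lambda>X. Q (\<lambda>u. c * X u)" k "\<lambda>X. fps_nth c 0 ^ d * Q X" t])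
      show "(\<lambda>X. Q (\<lambda>u. c * X u)) \<in> polyfun k"
        by (rule polyfun_scale[OF Q])
      show "(\<lambda>X. fps_nth c 0 ^ d * Q X) \<in> polyfun k"
        by (intro polyfun_mult polyfun_const Q)
      fix X :: "'n \<Rightarrow> complex fps" assume X: "fps_nth (X t) 0 \<noteq> 0"
      have "delay q (\<lambda>u. c * X u) = (\<lambda>u. c * delay q X u)"
        by (auto simp: delay_def fun_eq_iff)
      \<comment> \<open>Of the \<open>Suc d\<close> factors c(0), one is absorbed by the constant
        term of \<open>c * X t\<close>; hence the degree of \<open>Q\<close> drops to
        \<open>d\<close>.\<close>
      then have "fps_nth (c * X t) 0 * Q (\<lambda>u. c * X u) = fps_nth c 0 ^ Suc d * (fps_nth (X t) 0 * Q X)"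
        using Suc.prems(1) c PQ[of X] PQ[of "\<lambda>u. c * X u"] by (auto simp: covariant_def)
      then show "Q (\<lambda>u. c * X u) = fps_nth c 0 ^ d * Q X"
        using c X by simp
    qed
  qed
  from IH[OF this] obtain c where c: "\<And>X. Q X = (\<Sum>w\<in>words d. c w * word_poly w X)" by blast
  define c' where "c' w = (if hd w = t then c (tl w) else 0)" for w
  define S where "S X = (\<Sum>w\<in>words (Suc d). c' w * word_poly w X)" for X
  have S: "S X = (\<Sum>w\<in>words d. c w * word_poly (t # w) X)" for X
    unfolding S_def sum_words_Suc c'_def by (subst sum.swap) (simp add: if_distrib[of "\<lambda>x. x * _"] cong: if_cong)
  have w: "word_poly w \<in> covariant k (Suc d)" if "w \<in> words (Suc d)" for w :: "'n list"
    using word_poly_covariant[of w k] that d by (simp add: words_def)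
  have "S \<in> polyfun k"
    unfolding S_def using w by (intro polyfun_sum finite_words polyfun_mult polyfun_const) (auto simp: covariant_def)
  moreover have "S (\<lambda>t. c * X t) = fps_nth c 0 ^ Suc d * S X" if "fps_nth c 0 \<noteq> 0" for c X
    unfolding S_def sum_distrib_left
    using w that by (intro sum.cong refl) (simp add: covariant_def mult_ac)
  ultimately have "(\<lambda>X. P X - S X) \<in> covariant k (Suc d)"
    using Suc.prems(1) by (simp add: covariant_def polyfun_diff right_diff_distrib)
  \<comment> \<open>By \<open>word_poly_delay_Cons\<close>, each word \<open>t # w\<close>
    contributes X_t(0) times the determinant of \<open>w\<close>, which reassembles X_t(0) times
    \<open>Q\<close>.\<close>
  moreover have "S (delay q X) = P (delay q X)" for X
    using word_poly_delay_Cons[of t _ X] by (simp add: S PQ c t sum_distrib_left mult_ac)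
  ultimately obtain b where "\<And>X. P X - S X = (\<Sum>w\<in>words (Suc d). b w * word_poly w X)"
    using Suc.IH[of "\<lambda>X. P X - S X"] Suc.prems(3) by auto
  then have "P X = (\<Sum>w\<in>words (Suc d). (b w + c' w) * word_poly w X)" for X
    by (simp add: diff_eq_eq S_def distrib_right sum.distrib)
  then show ?case by (intro exI[of _ "\<lambda>w. b w + c' w"] allI)
qed

theorem covariant_span:
  fixes P :: "('n::finite \<Rightarrow> complex fps) \<Rightarrow> complex"
  shows "P \<in> covariant k d \<Longrightarrow> d \<le> Suc k \<Longrightarrow> \<exists>c. \<forall>X. P X = (\<Sum>w\<in>words d. c w * word_poly w X)"
proof (induction d arbitrary: P)
  case 0
  have "P X = P (\<lambda>_. 0)" for X using covariant_0_const 0 by blast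
  then show ?case
    by (intro exI[of _ "\<lambda>_. P (\<lambda>_. 0)"]) (simp add: words_def word_poly_def word_mat_def det_def)
next
  case (Suc d)
  have "P (delay CARD('n) X) = 0" for X
  proof -
    have "delay CARD('n) X = (\<lambda>t. fps_X * X t)"
      by (simp add: delay_def coord_rank_less fun_eq_iff)
    then show ?thesis using covariant_vanish[OF Suc.prems(1), of X] by simp
  qed
  then show ?case
    using Suc by (intro covariant_span_delay[of k d P "CARD('n)"]) auto
qed

theorem word_poly_independent:
  fixes c :: "'n::finite list \<Rightarrow> complex"
  shows "(\<And>X. (\<Sum>w\<in>words d. c w * word_poly w X) = 0) \<Longrightarrow> w \<in> words d \<Longrightarrow> c w = 0"
proof (induction d arbitrary: c w)
  case 0
  then show ?case by (simp add: words_def word_poly_def word_mat_def det_def)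
next
  case (Suc d)
  have "\<forall>w\<in>words d. c (t # w) = 0" for t
  \<comment> \<open>First letters are treated from the largest down:
    \<open>delay (coord_rank t)\<close> kills the words beginning with a smaller letter, and those
    beginning with a larger one already have coefficient 0.\<close>
  proof (induction "CARD('n) - coord_rank t" arbitrary: t rule: less_induct)
    case less
    have "(\<Sum>w\<in>words d. c (t # w) * word_poly w X) = 0" for X
    proof (rule polyfun_cancel[of "\<lambda>X. \<Sum>w\<in>words d. c (t # w) * word_poly w X" d "\<lambda>X. 0" t 1])
      show "(\<lambda>X. \<Sum>w\<in>words d. c (t # w) * word_poly w X) \<in> polyfun d"
        by (intro polyfun_sum finite_words polyfun_mult polyfun_const word_poly_polyfun) (simp add: words_def)
      show "fps_nth (X t) 0 ^ 1 * (\<Sum>w\<in>words d. c (t # w) * word_poly w X) = fps_nth (X t) 0 ^ 1 * 0" for X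
      proof -
        have "(\<Sum>w\<in>words d. c (u # w) * word_poly (u # w) (delay (coord_rank t) X)) = 0" if "u \<noteq> t" for u
        proof (cases "coord_rank u < coord_rank t")
          case False
          with that have "coord_rank t < coord_rank u"
            by (meson coord_rank_eq_iff linorder_neqE_nat)
          then show ?thesis using less[of u] coord_rank_less[of u] by simp
        qed (simp add: word_poly_delay_eq_0)
        then have "(\<Sum>u\<in>UNIV. \<Sum>w\<in>words d. c (u # w) * word_poly (u # w) (delay (coord_rank t) X))
            = (\<Sum>w\<in>words d. c (t # w) * word_poly (t # w) (delay (coord_rank t) X))"
          by (subst sum.remove[of _ t]) (auto intro: sum.neutral)
        then show ?thesis
          using Suc.prems(1)[of "delay (coord_rank t) X"]
          by (simp add: sum_words_Suc word_poly_delay_Cons sum_distrib_left mult_ac)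
      qed
    qed (rule polyfun_const)
    then show ?case using Suc.IH[of "\<lambda>w. c (t # w)"] by blast
  qed
  then show ?case using Suc.prems(2) by (auto simp: words_Suc)
qed

section \<open>Evaluation of jet polynomials\<close>

text \<open>The values lie in a general semiring because monomials are evaluated both at complex
  numbers and at power series.\<close>

definition mono_eval :: "('v \<Rightarrow>\<^sub>0 nat) \<Rightarrow> ('v \<Rightarrow> 'a::comm_semiring_1) \<Rightarrow> 'a" where
  "mono_eval m y = (\<Prod>v\<in>Poly_Mapping.keys m. y v ^ Poly_Mapping.lookup m v)"

lemma mono_eval_superset:
  assumes "finite A" "Poly_Mapping.keys m \<subseteq> A"
  shows "mono_eval m y = (\<Prod>v\<in>A. y v ^ Poly_Mapping.lookup m v)"
  unfolding mono_eval_def using assms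
  by (intro prod.mono_neutral_left) (auto simp: in_keys_iff)

lemma mono_eval_add: "mono_eval (m + m') y = mono_eval m y * mono_eval m' y"
proof -
  let ?A = "Poly_Mapping.keys m \<union> Poly_Mapping.keys m'"
  have "Poly_Mapping.keys (m + m') \<subseteq> ?A" by (rule Poly_Mapping.keys_add)
  then show ?thesis
    by (simp add: mono_eval_superset[of ?A] lookup_add power_add prod.distrib)
qed

lemma mono_eval_0: "mono_eval 0 y = 1"
  by (simp add: mono_eval_def)

lemma mono_eval_single: "mono_eval (Poly_Mapping.single v n) y = y v ^ n"
  by (cases "n = 0") (simp_all add: mono_eval_def)

lemma mono_eval_mult: "mono_eval m (\<lambda>v. y v * z v) = mono_eval m y * mono_eval m z"
  by (simp add: mono_eval_def power_mult_distrib prod.distrib)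

definition jeval :: "(('v \<Rightarrow>\<^sub>0 nat) \<Rightarrow>\<^sub>0 ('x \<Rightarrow> complex)) \<Rightarrow> 'x \<Rightarrow> ('v \<Rightarrow> complex) \<Rightarrow> complex" where
  "jeval P x y = (\<Sum>m\<in>Poly_Mapping.keys P. Poly_Mapping.lookup P m x * mono_eval m y)"

lemma jeval_superset:
  assumes "finite A" "Poly_Mapping.keys P \<subseteq> A"
  shows "jeval P x y = (\<Sum>m\<in>A. Poly_Mapping.lookup P m x * mono_eval m y)"
  unfolding jeval_def using assms
  by (intro sum.mono_neutral_left) (auto simp: in_keys_iff)

lemma jeval_0 [simp]: "jeval 0 x y = 0"
  by (simp add: jeval_def)

lemma jeval_add: "jeval (P + Q) x y = jeval P x y + jeval Q x y"
proof -
  let ?A = "Poly_Mapping.keys P \<union> Poly_Mapping.keys Q"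
  have "Poly_Mapping.keys (P + Q) \<subseteq> ?A" by (rule Poly_Mapping.keys_add)
  then show ?thesis
    by (simp add: jeval_superset[of ?A] lookup_add distrib_right sum.distrib)
qed

lemma jeval_sum: "jeval (\<Sum>a\<in>A. P a) x y = (\<Sum>a\<in>A. jeval (P a) x y)"
  by (induction A rule: infinite_finite_induct) (simp_all add: jeval_add)

lemma jeval_single: "jeval (Poly_Mapping.single m f) x y = f x * mono_eval m y"
  by (cases "f = 0") (simp_all add: jeval_def)

lemma jeval_coeff_poly: "jeval (coeff_poly f) x y = f x"
  by (simp add: coeff_poly_def jeval_single mono_eval_0)

lemma poly_mapping_sum_single:
  "P = (\<Sum>m\<in>Poly_Mapping.keys P. Poly_Mapping.single m (Poly_Mapping.lookup P m))"
  by (rule poly_mapping_eqI)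
    (auto simp: lookup_sum lookup_single when_def in_keys_iff sum.delta)

lemma poly_mapping_mult_sum_single:
  "P * Q = (\<Sum>m\<in>Poly_Mapping.keys P. \<Sum>m'\<in>Poly_Mapping.keys Q.
      Poly_Mapping.single (m + m') (Poly_Mapping.lookup P m * Poly_Mapping.lookup Q m'))"
  by (subst poly_mapping_sum_single[of P], subst poly_mapping_sum_single[of Q])
    (simp add: sum_product mult_single)

lemma jeval_mult: "jeval (P * Q) x y = jeval P x y * jeval Q x y"
  unfolding poly_mapping_mult_sum_single[of P Q]
  by (simp add: jeval_sum jeval_single mono_eval_add) (simp add: jeval_def sum_product mult_ac)

lemma jeval_1: "jeval 1 x y = 1"
  using jeval_single[of 0 1 x y] by (simp add: mono_eval_0)

lemma jeval_power: "jeval (P ^ n) x y = jeval P x y ^ n"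
  by (induction n) (simp_all add: jeval_1 jeval_mult)

lemma jeval_prod: "jeval (\<Prod>a\<in>A. P a) x y = (\<Prod>a\<in>A. jeval (P a) x y)"
  by (induction A rule: infinite_finite_induct) (simp_all add: jeval_1 jeval_mult)

text \<open>Dedekind's argument for the independence of characters.\<close>

lemma monomials_independent:
  fixes a :: "('v \<Rightarrow>\<^sub>0 nat) \<Rightarrow> complex"
  assumes "finite A" "\<And>y. (\<Sum>m\<in>A. a m * mono_eval m y) = 0"
  shows "\<forall>m\<in>A. a m = 0"
  using assms
proof (induction A arbitrary: a rule: finite_induct)
  case (insert m0 A)
  have "a m1 = 0" if m1: "m1 \<in> A" for m1
  proof -
    from m1 insert.hyps obtain v where v: "Poly_Mapping.lookup m0 v \<noteq> Poly_Mapping.lookup m1 v"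
      by (metis poly_mapping_eqI)
    \<comment> \<open>Doubling only the variable \<open>v\<close>, in which the two exponents
      differ, multiplies the two monomials by different powers of 2.\<close>
    define z :: "'v \<Rightarrow> complex" where "z u = (if u = v then 2 else 1)" for u
    have z: "mono_eval m z = 2 ^ Poly_Mapping.lookup m v" for m
      unfolding mono_eval_superset[of "insert v (Poly_Mapping.keys m)" m z, OF _ subset_insertI, simplified]
      by (simp add: z_def prod.insert_remove)
    have "(\<Sum>m\<in>A. a m * (mono_eval m z - mono_eval m0 z) * mono_eval m y) = 0" for y
    proof -
      have "(\<Sum>m\<in>insert m0 A. a m * mono_eval m (\<lambda>v. z v * y v)) - mono_eval m0 z * (\<Sum>m\<in>insert m0 A. a m * mono_eval m y) = 0"
        by (simp only: insert.prems) simp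
      then show ?thesis
        using insert.hyps by (simp add: mono_eval_mult algebra_simps sum_distrib_left flip: sum_subtractf)
    qed
    then have "a m1 * (mono_eval m1 z - mono_eval m0 z) = 0"
      using insert.IH[of "\<lambda>m. a m * (mono_eval m z - mono_eval m0 z)"] m1 by blast
    moreover have "(2 :: complex) ^ p \<noteq> 2 ^ q" if "p \<noteq> q" for p q :: nat
      using that by (metis norm_numeral norm_power one_less_numeral_iff power_inject_exp semiring_norm(76))
    ultimately show "a m1 = 0" using v by (simp add: z)
  qed
  moreover from this have "a m0 * mono_eval m0 (\<lambda>_. 1) = 0"
    using insert.prems[of "\<lambda>_. 1"] insert.hyps by simp
  ultimately show ?case by (simp add: mono_eval_def)
qed simp

text \<open>The gluing condition speaks of coefficients at a point, while the argument computes
  values. All \<open>y\<close> are required, including values of variables that do not belong to the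
  chart.\<close>

lemma lookup_eq_of_jeval_eq:
  assumes "\<And>y. a * jeval P x y = b * jeval Q x' y"
  shows "a * Poly_Mapping.lookup P m x = b * Poly_Mapping.lookup Q m x'"
proof -
  let ?A = "insert m (Poly_Mapping.keys P \<union> Poly_Mapping.keys Q)"
  have "\<forall>m\<in>?A. a * Poly_Mapping.lookup P m x - b * Poly_Mapping.lookup Q m x' = 0"
  proof (rule monomials_independent)
    show "(\<Sum>m\<in>?A. (a * Poly_Mapping.lookup P m x - b * Poly_Mapping.lookup Q m x') * mono_eval m y) = 0" for y
    proof -
      have "jeval P x y = (\<Sum>m\<in>?A. Poly_Mapping.lookup P m x * mono_eval m y)"
        "jeval Q x' y = (\<Sum>m\<in>?A. Poly_Mapping.lookup Q m x' * mono_eval m y)"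
        by (intro jeval_superset; auto)+
      with assms[of y] show ?thesis
        by (simp only: left_diff_distrib sum_subtractf sum_distrib_left mult.assoc) simp
    qed
  qed simp
  then show ?thesis by simp
qed

definition slice :: "'n::finite \<Rightarrow> complex ^ 'n \<Rightarrow> complex \<Rightarrow> complex ^ 'n" where
  "slice t x z = (\<chi> m. if m = t then z else x $ m)"

lemma slice_self: "slice t x (x $ t) = x"
  by (simp add: slice_def Finite_Cartesian_Product.vec_eq_iff)

lemma homog_nth: "homog i x $ t = (if t = i then 1 else x $ t)"
  by (simp add: homog_def)

lemma eventually_slice_overlap:
  assumes "x \<in> overlap i j"
  shows "\<forall>\<^sub>F z in nhds (x $ t). slice t x z \<in> overlap i j"
proof (cases "j = t \<and> j \<noteq> i")
  case True
  then have "x $ t \<noteq> 0" using assms by (auto simp: overlap_def homog_nth)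
  then have "\<forall>\<^sub>F z in nhds (x $ t). z \<noteq> 0" by (rule t1_space_nhds)
  then show ?thesis by eventually_elim (use True in \<open>auto simp: overlap_def homog_nth slice_def\<close>)
next
  case False
  then have "slice t x z \<in> overlap i j" for z
    using assms by (auto simp: overlap_def homog_nth slice_def split: if_splits)
  then show ?thesis by simp
qed

section \<open>The change of charts on curves\<close>

text \<open>\<open>lift i j f g\<close> says that \<open>g\<close> extends the rational function \<open>f\<close> from points of the chart
  \<open>U\<^sub>i\<close> to power series; only curves with \<open>X i = 1\<close> and \<open>X j\<close> invertible are relevant.\<close>

inductive lift :: "'n::finite \<Rightarrow> 'n \<Rightarrow> (complex ^ 'n \<Rightarrow> complex) \<Rightarrow> (('n \<Rightarrow> complex fps) \<Rightarrow> complex fps) \<Rightarrow> bool"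
  for i j where
  lift_const: "(\<And>x. x \<in> overlap i j \<Longrightarrow> f x = c) \<Longrightarrow> lift i j f (\<lambda>X. fps_const c)"
| lift_coord: "(\<And>x. x \<in> overlap i j \<Longrightarrow> f x = homog i x $ t) \<Longrightarrow> lift i j f (\<lambda>X. X t)"
| lift_inverse: "(\<And>x. x \<in> overlap i j \<Longrightarrow> f x = inverse (homog i x $ j)) \<Longrightarrow> lift i j f (\<lambda>X. inverse (X j))"
| lift_add: "lift i j f1 g1 \<Longrightarrow> lift i j f2 g2 \<Longrightarrow> (\<And>x. x \<in> overlap i j \<Longrightarrow> f x = f1 x + f2 x) \<Longrightarrow>
    lift i j f (\<lambda>X. g1 X + g2 X)"
| lift_mult: "lift i j f1 g1 \<Longrightarrow> lift i j f2 g2 \<Longrightarrow> (\<And>x. x \<in> overlap i j \<Longrightarrow> f x = f1 x * f2 x) \<Longrightarrow>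
    lift i j f (\<lambda>X. g1 X * g2 X)"

text \<open>Each rule constrains \<open>f\<close> on the overlap alone. This freedom is needed for
  \<open>partial_deriv\<close>, whose formula is known only there.\<close>

lemma lift_cong:
  assumes "lift i j f g" "\<And>x. x \<in> overlap i j \<Longrightarrow> f' x = f x"
  shows "lift i j f' g"
  using assms(1)
proof cases
  case (lift_const c)
  then show ?thesis using assms(2) by (auto intro: lift.lift_const)
next
  case (lift_coord t)
  then show ?thesis using assms(2) by (auto intro: lift.lift_coord)
next
  case lift_inverse
  then show ?thesis using assms(2) by (auto intro: lift.lift_inverse)
next
  case (lift_add f1 g1 f2 g2)
  then show ?thesis using assms(2) by (auto intro: lift.lift_add)
next
  case (lift_mult f1 g1 f2 g2)
  then show ?thesis using assms(2) by (auto intro: lift.lift_mult)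
qed

lemma lift_eval:
  assumes "lift i j f g" "x \<in> overlap i j" "\<And>t. fps_nth (X t) 0 = homog i x $ t"
  shows "fps_nth (g X) 0 = f x"
  using assms(1) by induction (use assms(2,3) in auto)

text \<open>The chain rule along a curve, with partial derivatives that are again liftable so that
  it can be iterated. The sum omits \<open>i\<close> because \<open>X i = 1\<close> has derivative
  0.\<close>

lemma lift_has_derivative:
  assumes "lift i j f g"
  shows "\<exists>F G. (\<forall>t. lift i j (F t) (G t)) \<and>
    (\<forall>t. \<forall>x\<in>overlap i j. ((\<lambda>z. f (slice t x z)) has_field_derivative F t x) (at (x $ t))) \<and>
    (\<forall>X. X i = 1 \<longrightarrow> fps_nth (X j) 0 \<noteq> 0 \<longrightarrow> fps_deriv (g X) = (\<Sum>t\<in>-{i}. G t X * fps_deriv (X t)))"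
proof -
  \<comment> \<open>Differentiation is local, so the derivative may be computed for the explicit
    expression \<open>h\<close> that \<open>f\<close> equals on the overlap.\<close>
  have transf: "((\<lambda>z. f (slice t x z)) has_field_derivative D) (at (x $ t))"
    if "x \<in> overlap i j" "\<And>x. x \<in> overlap i j \<Longrightarrow> f x = h x"
      "((\<lambda>z. h (slice t x z)) has_field_derivative D) (at (x $ t))" for f h t D and x :: "complex ^ 'a"
  proof -
    have "\<forall>\<^sub>F z in nhds (x $ t). f (slice t x z) = h (slice t x z)"
      using eventually_slice_overlap[OF that(1), of t] by eventually_elim (rule that(2))
    then show ?thesis using that(3) by (subst DERIV_cong_ev[OF refl _ refl]) 
  qed
  show ?thesis
    using assms
  proof induction
    case (lift_const f c)
    have "lift i j (\<lambda>_. 0) (\<lambda>_. fps_const 0)" by (rule lift.lift_const) simp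
    then show ?case
      by (intro exI[of _ "\<lambda>_ _. 0"] exI[of _ "\<lambda>_ _. fps_const 0"] conjI allI ballI impI)
        (auto intro!: transf[OF _ lift_const])
  next
    case (lift_coord f u)
    let ?c = "\<lambda>t. if t = u \<and> u \<noteq> i then 1 else 0"
    have "((\<lambda>z. f (slice t x z)) has_field_derivative ?c t) (at (x $ t))" if "x \<in> overlap i j" for t x
    proof (rule transf[OF that lift_coord])
      have "(\<lambda>z. homog i (slice t x z) $ u) = (if t = u \<and> u \<noteq> i then (\<lambda>z. z) else (\<lambda>_. homog i x $ u))"
        by (auto simp: homog_nth slice_def fun_eq_iff)
      then show "((\<lambda>z. homog i (slice t x z) $ u) has_field_derivative ?c t) (at (x $ t))" by simp
    qed
    moreover have "fps_deriv (X u) = (\<Sum>t\<in>-{i}. fps_const (?c t) * fps_deriv (X t))" if "X i = 1" for X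
    proof (cases "u = i")
      case False
      then have "(\<Sum>t\<in>-{i}. fps_const (?c t) * fps_deriv (X t)) = (\<Sum>t\<in>-{i}. if t = u then fps_deriv (X u) else 0)"
        by (intro sum.cong) auto
      with False show ?thesis by simp
    qed (use that in simp)
    moreover have "lift i j (\<lambda>_. ?c t) (\<lambda>_. fps_const (?c t))" for t
      by (rule lift.lift_const) simp
    ultimately show ?case
      by (intro exI[of _ "\<lambda>t _. ?c t"] exI[of _ "\<lambda>t _. fps_const (?c t)"] conjI allI ballI impI)
  next
    case (lift_inverse f)
    \<comment> \<open>For \<open>j = i\<close> the inverted coordinate is constantly 1 and no slice
      direction changes it.\<close>
    let ?c = "\<lambda>t. if t = j \<and> j \<noteq> i then -1 else 0 :: complex"
    let ?F = "\<lambda>t x. ?c t * (inverse (homog i x $ j) * inverse (homog i x $ j))"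
    have "((\<lambda>z. f (slice t x z)) has_field_derivative ?F t x) (at (x $ t))" if x: "x \<in> overlap i j" for t x
    proof (rule transf[OF x lift_inverse])
      show "((\<lambda>z. inverse (homog i (slice t x z) $ j)) has_field_derivative ?F t x) (at (x $ t))"
      proof (cases "t = j \<and> j \<noteq> i")
        case True
        then have "x $ t \<noteq> 0" using x by (auto simp: overlap_def homog_nth)
        then have "(inverse has_field_derivative - (inverse (x $ t) ^ 2)) (at (x $ t))"
          using DERIV_inverse[of "x $ t"] by (simp add: numeral_2_eq_2)
        then show ?thesis using True by (simp add: slice_def homog_nth power2_eq_square)
      next
        case False
        then have "(\<lambda>z. inverse (homog i (slice t x z) $ j)) = (\<lambda>_. inverse (homog i x $ j))"
          by (auto simp: slice_def homog_nth fun_eq_iff)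
        with False show ?thesis by (simp only: if_False mult_zero_left DERIV_const)
      qed
    qed
    moreover have "fps_deriv (inverse (X j)) =
        (\<Sum>t\<in>-{i}. fps_const (?c t) * (inverse (X j) * inverse (X j)) * fps_deriv (X t))"
      if X: "X i = 1" "fps_nth (X j) 0 \<noteq> 0" for X
    proof (cases "j = i")
      case False
      then have "(\<Sum>t\<in>-{i}. fps_const (?c t) * (inverse (X j) * inverse (X j)) * fps_deriv (X t)) =
          (\<Sum>t\<in>-{i}. if t = j then - (inverse (X j) * inverse (X j)) * fps_deriv (X j) else 0)"
        by (intro sum.cong) (auto simp flip: fps_const_neg)
      with False show ?thesis by (simp add: fps_inverse_deriv[OF X(2)] power2_eq_square mult_ac)
    qed (use that in simp)
    moreover have "lift i j (?F t) (\<lambda>X. fps_const (?c t) * (inverse (X j) * inverse (X j)))" for t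
      by (rule lift_mult[OF lift_const[of _ _ "\<lambda>_. ?c t"] lift_mult[OF lift.lift_inverse[OF refl] lift.lift_inverse[OF refl]]]) auto
    ultimately show ?case
      by (intro exI[of _ ?F] exI[of _ "\<lambda>t X. fps_const (?c t) * (inverse (X j) * inverse (X j))"] conjI allI ballI impI)
  next
    case (lift_add f1 g1 f2 g2 f)
    then obtain F1 G1 F2 G2 where 1: "\<And>t. lift i j (F1 t) (G1 t)"
      "\<And>t x. x \<in> overlap i j \<Longrightarrow> ((\<lambda>z. f1 (slice t x z)) has_field_derivative F1 t x) (at (x $ t))"
      "\<And>X. X i = 1 \<Longrightarrow> fps_nth (X j) 0 \<noteq> 0 \<Longrightarrow> fps_deriv (g1 X) = (\<Sum>t\<in>-{i}. G1 t X * fps_deriv (X t))"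
      and 2: "\<And>t. lift i j (F2 t) (G2 t)"
      "\<And>t x. x \<in> overlap i j \<Longrightarrow> ((\<lambda>z. f2 (slice t x z)) has_field_derivative F2 t x) (at (x $ t))"
      "\<And>X. X i = 1 \<Longrightarrow> fps_nth (X j) 0 \<noteq> 0 \<Longrightarrow> fps_deriv (g2 X) = (\<Sum>t\<in>-{i}. G2 t X * fps_deriv (X t))"
      by blast
    show ?case
    proof (intro exI[of _ "\<lambda>t x. F1 t x + F2 t x"] exI[of _ "\<lambda>t X. G1 t X + G2 t X"] conjI allI ballI impI)
      show "lift i j (\<lambda>x. F1 t x + F2 t x) (\<lambda>X. G1 t X + G2 t X)" for t
        by (rule lift.lift_add[OF 1(1) 2(1) refl])
      show "((\<lambda>z. f (slice t x z)) has_field_derivative F1 t x + F2 t x) (at (x $ t))" if "x \<in> overlap i j" for t x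
        by (rule transf[OF that lift_add.hyps(3)]) (auto intro!: DERIV_add 1(2) 2(2) that)
    qed (simp add: 1(3) 2(3) sum.distrib distrib_right)
  next
    case (lift_mult f1 g1 f2 g2 f)
    then obtain F1 G1 F2 G2 where 1: "\<And>t. lift i j (F1 t) (G1 t)"
      "\<And>t x. x \<in> overlap i j \<Longrightarrow> ((\<lambda>z. f1 (slice t x z)) has_field_derivative F1 t x) (at (x $ t))"
      "\<And>X. X i = 1 \<Longrightarrow> fps_nth (X j) 0 \<noteq> 0 \<Longrightarrow> fps_deriv (g1 X) = (\<Sum>t\<in>-{i}. G1 t X * fps_deriv (X t))"
      and 2: "\<And>t. lift i j (F2 t) (G2 t)"
      "\<And>t x. x \<in> overlap i j \<Longrightarrow> ((\<lambda>z. f2 (slice t x z)) has_field_derivative F2 t x) (at (x $ t))"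
      "\<And>X. X i = 1 \<Longrightarrow> fps_nth (X j) 0 \<noteq> 0 \<Longrightarrow> fps_deriv (g2 X) = (\<Sum>t\<in>-{i}. G2 t X * fps_deriv (X t))"
      by blast
    show ?case
    proof (intro exI[of _ "\<lambda>t x. F1 t x * f2 x + F2 t x * f1 x"]
        exI[of _ "\<lambda>t X. G1 t X * g2 X + G2 t X * g1 X"] conjI allI ballI impI)
      show "lift i j (\<lambda>x. F1 t x * f2 x + F2 t x * f1 x) (\<lambda>X. G1 t X * g2 X + G2 t X * g1 X)" for t
        by (rule lift.lift_add[OF lift.lift_mult[OF 1(1) lift_mult.hyps(2) refl]
              lift.lift_mult[OF 2(1) lift_mult.hyps(1) refl] refl])
      show "((\<lambda>z. f (slice t x z)) has_field_derivative F1 t x * f2 x + F2 t x * f1 x) (at (x $ t))"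
        if "x \<in> overlap i j" for t x
        by (rule transf[OF that lift_mult.hyps(3)])
          (use DERIV_mult[OF 1(2)[OF that] 2(2)[OF that]] in \<open>simp_all add: slice_self\<close>)
      fix X :: "'a \<Rightarrow> complex fps" assume X: "X i = 1" "fps_nth (X j) 0 \<noteq> 0"
      show "fps_deriv (g1 X * g2 X) = (\<Sum>t\<in>-{i}. (G1 t X * g2 X + G2 t X * g1 X) * fps_deriv (X t))"
        unfolding fps_deriv_mult 1(3)[OF X] 2(3)[OF X] sum_distrib_left sum_distrib_right sum.distrib[symmetric]
        by (intro sum.cong refl) (simp only: algebra_simps)
    qed
  qed
qed

lemma lift_partial_deriv:
  assumes "lift i j f g"
  obtains G where "\<And>t. lift i j (partial_deriv t f) (G t)"
    "\<And>X. X i = 1 \<Longrightarrow> fps_nth (X j) 0 \<noteq> 0 \<Longrightarrow> fps_deriv (g X) = (\<Sum>t\<in>-{i}. G t X * fps_deriv (X t))"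
proof -
  obtain F G where *: "\<And>t. lift i j (F t) (G t)"
      "\<And>t x. x \<in> overlap i j \<Longrightarrow> ((\<lambda>z. f (slice t x z)) has_field_derivative F t x) (at (x $ t))"
      "\<And>X. X i = 1 \<Longrightarrow> fps_nth (X j) 0 \<noteq> 0 \<Longrightarrow> fps_deriv (g X) = (\<Sum>t\<in>-{i}. G t X * fps_deriv (X t))"
    using lift_has_derivative[OF assms] by blast
  have "lift i j (partial_deriv t f) (G t)" for t
  proof (rule lift_cong[OF *(1)])
    show "partial_deriv t f x = F t x" if "x \<in> overlap i j" for x
      unfolding partial_deriv_def slice_def[symmetric] by (rule DERIV_imp_deriv[OF *(2)[OF that]])
  qed
  then show ?thesis using *(3) by (rule that[of G])
qed

section \<open>Formal differentiation as differentiation along curves\<close>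

text \<open>Jet variables take whole power series as values so that they can be differentiated
  again; the numerical jets are their constant terms, \<open>fact l\<close> times Taylor
  coefficients.\<close>

definition jets :: "('n \<Rightarrow> complex fps) \<Rightarrow> 'n \<times> nat \<Rightarrow> complex fps" where
  "jets Y = (\<lambda>(t, l). (fps_deriv ^^ l) (Y t))"

lemma jets_Suc: "fps_deriv (jets Y (t, l)) = jets Y (t, Suc l)"
  by (simp add: jets_def)

lemma fps_nth_funpow_deriv:
  "fps_nth ((fps_deriv ^^ l) f) n = fact (n + l) / fact n * (fps_nth f (n + l) :: complex)"
proof (induction l arbitrary: n)
  case (Suc l)
  have "fps_nth ((fps_deriv ^^ Suc l) f) n = of_nat (Suc n) * (fact (Suc n + l) / fact (Suc n) * fps_nth f (Suc n + l))"
    by (simp add: Suc)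
  also have "\<dots> = fact (n + Suc l) / fact n * fps_nth f (n + Suc l)"
    by (simp add: field_simps del: of_nat_Suc)
  finally show ?case .
qed simp

lemma jets_nth_0: "fps_nth (jets Y (t, l)) 0 = fact l * fps_nth (Y t) l"
  by (simp add: jets_def fps_nth_funpow_deriv)

lemma fps_deriv_prod:
  fixes f :: "'v \<Rightarrow> complex fps"
  assumes "finite A"
  shows "fps_deriv (\<Prod>v\<in>A. f v) = (\<Sum>v\<in>A. fps_deriv (f v) * (\<Prod>u\<in>A - {v}. f u))"
  using assms
proof (induction A rule: finite_induct)
  case (insert a A)
  have "(\<Prod>u\<in>insert a A - {v}. f u) = f a * (\<Prod>u\<in>A - {v}. f u)" if "v \<in> A" for v
    using insert.hyps that by (subst insert_Diff_if) auto
  then have "(\<Sum>v\<in>A. fps_deriv (f v) * (\<Prod>u\<in>insert a A - {v}. f u)) =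
      f a * (\<Sum>v\<in>A. fps_deriv (f v) * (\<Prod>u\<in>A - {v}. f u))"
    by (simp add: sum_distrib_left mult_ac)
  moreover have "insert a A - {a} = A" using insert.hyps by auto
  ultimately show ?case
    using insert by simp
qed simp

lemma fps_deriv_mono_eval:
  "fps_deriv (mono_eval m y) = (\<Sum>v\<in>Poly_Mapping.keys m.
     fps_const (of_nat (Poly_Mapping.lookup m v)) * mono_eval (m - Poly_Mapping.single v 1) y * fps_deriv (y v))"
  for y :: "'v \<Rightarrow> complex fps"
proof -
  let ?K = "Poly_Mapping.keys m"
  have "fps_deriv (y v ^ Poly_Mapping.lookup m v) * (\<Prod>u\<in>?K - {v}. y u ^ Poly_Mapping.lookup m u) =
      fps_const (of_nat (Poly_Mapping.lookup m v)) * mono_eval (m - Poly_Mapping.single v 1) y * fps_deriv (y v)"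
    if v: "v \<in> ?K" for v
  proof -
    have "Poly_Mapping.keys (m - Poly_Mapping.single v 1) \<subseteq> ?K"
      by (auto simp: in_keys_iff lookup_minus)
    then have "mono_eval (m - Poly_Mapping.single v 1) y = (\<Prod>u\<in>?K. y u ^ Poly_Mapping.lookup (m - Poly_Mapping.single v 1) u)"
      by (intro mono_eval_superset) auto
    also have "\<dots> = y v ^ (Poly_Mapping.lookup m v - 1) * (\<Prod>u\<in>?K - {v}. y u ^ Poly_Mapping.lookup m u)"
      using v by (subst prod.remove[of _ v]) (auto simp: lookup_minus lookup_single when_def intro!: prod.cong)
    finally show ?thesis
      by (simp add: fps_deriv_power mult_ac)
  qed
  then show ?thesis
    unfolding mono_eval_def[of m] by (subst fps_deriv_prod) auto
qed

text \<open>The coefficients are evaluated on \<open>X\<close> and the jet variables on \<open>Y\<close>.  Both agree up to constants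
  in the slots \<open>t \<noteq> i\<close>, but \<open>Y\<close> also has to realise arbitrary values of the jet variables with
  \<open>t = i\<close> or \<open>l = 0\<close>, which \<open>total_deriv\<close> and \<open>chart_change\<close> do not exclude syntactically.\<close>

definition lifts :: "'n::finite \<Rightarrow> 'n \<Rightarrow> 'n jet_poly \<Rightarrow>
    (('n \<Rightarrow> complex fps) \<Rightarrow> ('n \<Rightarrow> complex fps) \<Rightarrow> complex fps) \<Rightarrow> bool" where
  "lifts i j P G \<longleftrightarrow> (\<exists>A g. finite A \<and> Poly_Mapping.keys P \<subseteq> A \<and>
     (\<forall>m\<in>A. lift i j (Poly_Mapping.lookup P m) (g m)) \<and>
     G = (\<lambda>X Y. \<Sum>m\<in>A. g m X * mono_eval m (jets Y)))"

lemma lift_zero: "lift i j 0 (\<lambda>X. 0)"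
  using lift_const[of i j 0 0] by simp

lemma lifts_0: "lifts i j 0 (\<lambda>X Y. 0)"
  unfolding lifts_def by (intro exI[of _ "{}"]) simp

lemma lifts_add:
  assumes "lifts i j P G" "lifts i j Q H"
  shows "lifts i j (P + Q) (\<lambda>X Y. G X Y + H X Y)"
proof -
  obtain A g where 1: "finite A" "Poly_Mapping.keys P \<subseteq> A" "\<forall>m\<in>A. lift i j (Poly_Mapping.lookup P m) (g m)"
    and G: "G = (\<lambda>X Y. \<Sum>m\<in>A. g m X * mono_eval m (jets Y))"
    using assms(1) unfolding lifts_def by blast
  obtain B h where 2: "finite B" "Poly_Mapping.keys Q \<subseteq> B" "\<forall>m\<in>B. lift i j (Poly_Mapping.lookup Q m) (h m)"
    and H: "H = (\<lambda>X Y. \<Sum>m\<in>B. h m X * mono_eval m (jets Y))"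
    using assms(2) unfolding lifts_def by blast
  \<comment> \<open>Padding by 0 outside the original index set is consistent, since the coefficient
    of the polynomial is 0 there.\<close>
  define g' where "g' m = (if m \<in> A then g m else (\<lambda>X. 0))" for m
  define h' where "h' m = (if m \<in> B then h m else (\<lambda>X. 0))" for m
  have "G = (\<lambda>X Y. \<Sum>m\<in>A \<union> B. g' m X * mono_eval m (jets Y))"
    unfolding G using 1(1) 2(1) by (intro ext sum.mono_neutral_cong_left) (auto simp: g'_def)
  moreover have "H = (\<lambda>X Y. \<Sum>m\<in>A \<union> B. h' m X * mono_eval m (jets Y))"
    unfolding H using 1(1) 2(1) by (intro ext sum.mono_neutral_cong_left) (auto simp: h'_def)
  moreover have "lift i j (Poly_Mapping.lookup P m) (g' m)" for m
  proof (cases "m \<in> A")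
    case False
    then have "Poly_Mapping.lookup P m = 0" using 1(2) by (auto simp: in_keys_iff)
    with False show ?thesis by (simp only: g'_def if_False lift_zero)
  qed (use 1(3) in \<open>simp add: g'_def\<close>)
  moreover have "lift i j (Poly_Mapping.lookup Q m) (h' m)" for m
  proof (cases "m \<in> B")
    case False
    then have "Poly_Mapping.lookup Q m = 0" using 2(2) by (auto simp: in_keys_iff)
    with False show ?thesis by (simp only: h'_def if_False lift_zero)
  qed (use 2(3) in \<open>simp add: h'_def\<close>)
  ultimately show ?thesis
    unfolding lifts_def using 1(1,2) 2(1,2) Poly_Mapping.keys_add[of P Q]
    by (intro exI[of _ "A \<union> B"] exI[of _ "\<lambda>m X. g' m X + h' m X"] conjI ballI lift_add)
      (auto simp: lookup_add distrib_right sum.distrib)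
qed

lemma lifts_sum:
  "finite A \<Longrightarrow> (\<And>a. a \<in> A \<Longrightarrow> lifts i j (P a) (G a)) \<Longrightarrow> lifts i j (\<Sum>a\<in>A. P a) (\<lambda>X Y. \<Sum>a\<in>A. G a X Y)"
  by (induction A rule: finite_induct) (auto intro: lifts_0 lifts_add)

lemma lifts_single:
  assumes "lift i j f g"
  shows "lifts i j (Poly_Mapping.single m f) (\<lambda>X Y. g X * mono_eval m (jets Y))"
  unfolding lifts_def using assms by (intro exI[of _ "{m}"] exI[of _ "\<lambda>_. g"]) simp

lemma single_mult_jet_var:
  "Poly_Mapping.single m f * jet_var t l = Poly_Mapping.single (m + Poly_Mapping.single (t, l) 1) f"
  by (simp add: jet_var_def mult_single)

lemma total_deriv_superset:
  assumes "finite A" "Poly_Mapping.keys P \<subseteq> A"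
  shows "total_deriv i P = (\<Sum>m\<in>A.
    (\<Sum>t\<in>-{i}. Poly_Mapping.single (m + Poly_Mapping.single (t, 1) 1) (partial_deriv t (Poly_Mapping.lookup P m))) +
    (\<Sum>(t, l)\<in>Poly_Mapping.keys m. Poly_Mapping.single (m - Poly_Mapping.single (t, l) 1 + Poly_Mapping.single (t, Suc l) 1)
       (\<lambda>x. of_nat (Poly_Mapping.lookup m (t, l)) * Poly_Mapping.lookup P m x)))"
  unfolding total_deriv_def single_mult_jet_var
proof (rule sum.mono_neutral_left)
  have "partial_deriv t 0 = 0" for t :: 'a
    by (simp add: partial_deriv_def fun_eq_iff)
  moreover have "Poly_Mapping.single m (\<lambda>x :: complex ^ 'a. 0 :: complex) = 0" for m :: "'a jet_monomial"
    unfolding zero_fun_def[symmetric] by (rule single_zero)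
  ultimately show "\<forall>m\<in>A - Poly_Mapping.keys P.
    (\<Sum>t\<in>-{i}. Poly_Mapping.single (m + Poly_Mapping.single (t, 1) 1) (partial_deriv t (Poly_Mapping.lookup P m))) +
    (\<Sum>(t, l)\<in>Poly_Mapping.keys m. Poly_Mapping.single (m - Poly_Mapping.single (t, l) 1 + Poly_Mapping.single (t, Suc l) 1)
       (\<lambda>x. of_nat (Poly_Mapping.lookup m (t, l)) * Poly_Mapping.lookup P m x)) = 0"
    by (auto simp: in_keys_iff case_prod_unfold)
qed (use assms in auto)

text \<open>The two halves of \<open>total_deriv\<close> are the two Leibniz terms: the chain rule
  for the coefficient and the derivative of the monomial. The agreement of derivatives lets
  \<open>jets Y (t, 1)\<close> stand for the derivative of \<open>X t\<close> in the chain
  rule.\<close>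

lemma lifts_total_deriv:
  assumes "lifts i j P G"
  obtains H where "lifts i j (total_deriv i P) H"
    "\<And>X Y. X i = 1 \<Longrightarrow> fps_nth (X j) 0 \<noteq> 0 \<Longrightarrow> (\<And>t. t \<noteq> i \<Longrightarrow> fps_deriv (X t) = fps_deriv (Y t)) \<Longrightarrow>
       H X Y = fps_deriv (G X Y)"
proof -
  obtain A g where A: "finite A" "Poly_Mapping.keys P \<subseteq> A" and g: "\<And>m. m \<in> A \<Longrightarrow> lift i j (Poly_Mapping.lookup P m) (g m)"
    and G: "G = (\<lambda>X Y. \<Sum>m\<in>A. g m X * mono_eval m (jets Y))"
    using assms unfolding lifts_def by blast
  have "\<exists>g'. \<forall>m\<in>A. (\<forall>t. lift i j (partial_deriv t (Poly_Mapping.lookup P m)) (g' m t)) \<and>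
    (\<forall>X. X i = 1 \<longrightarrow> fps_nth (X j) 0 \<noteq> 0 \<longrightarrow> fps_deriv (g m X) = (\<Sum>t\<in>-{i}. g' m t X * fps_deriv (X t)))"
  proof (rule bchoice, rule ballI)
    fix m assume "m \<in> A"
    show "\<exists>g'. (\<forall>t. lift i j (partial_deriv t (Poly_Mapping.lookup P m)) (g' t)) \<and>
      (\<forall>X. X i = 1 \<longrightarrow> fps_nth (X j) 0 \<noteq> 0 \<longrightarrow> fps_deriv (g m X) = (\<Sum>t\<in>-{i}. g' t X * fps_deriv (X t)))"
      by (rule lift_partial_deriv[OF g[OF \<open>m \<in> A\<close>]]) (intro exI conjI allI impI)
  qed
  then obtain g' where g': "\<And>m t. m \<in> A \<Longrightarrow> lift i j (partial_deriv t (Poly_Mapping.lookup P m)) (g' m t)"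
    "\<And>m X. m \<in> A \<Longrightarrow> X i = 1 \<Longrightarrow> fps_nth (X j) 0 \<noteq> 0 \<Longrightarrow>
      fps_deriv (g m X) = (\<Sum>t\<in>-{i}. g' m t X * fps_deriv (X t))"
    by blast
  define H where "H = (\<lambda>X Y. \<Sum>m\<in>A.
    (\<Sum>t\<in>-{i}. g' m t X * mono_eval (m + Poly_Mapping.single (t, 1) 1) (jets Y)) +
    (\<Sum>v\<in>Poly_Mapping.keys m. fps_const (of_nat (Poly_Mapping.lookup m v)) * g m X *
       mono_eval (m - Poly_Mapping.single v 1 + Poly_Mapping.single (fst v, Suc (snd v)) 1) (jets Y)))"
  have "lift i j (\<lambda>x. of_nat (Poly_Mapping.lookup m v) * Poly_Mapping.lookup P m x)
      (\<lambda>X. fps_const (of_nat (Poly_Mapping.lookup m v)) * g m X)" if "m \<in> A" for m v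
    by (rule lift_mult[OF lift_const[OF refl] g[OF that] refl])
  then have "lifts i j (total_deriv i P) H"
    unfolding total_deriv_superset[OF A] H_def case_prod_unfold prod.collapse
    by (intro lifts_sum lifts_add lifts_single A finite_keys finite g') simp_all
  moreover have "H X Y = fps_deriv (G X Y)"
    if X: "X i = 1" "fps_nth (X j) 0 \<noteq> 0" "\<And>t. t \<noteq> i \<Longrightarrow> fps_deriv (X t) = fps_deriv (Y t)" for X Y
  proof -
    have "fps_deriv (g m X * mono_eval m (jets Y)) =
       (\<Sum>t\<in>-{i}. g' m t X * mono_eval (m + Poly_Mapping.single (t, 1) 1) (jets Y)) +
       (\<Sum>v\<in>Poly_Mapping.keys m. fps_const (of_nat (Poly_Mapping.lookup m v)) * g m X *
         mono_eval (m - Poly_Mapping.single v 1 + Poly_Mapping.single (fst v, Suc (snd v)) 1) (jets Y))"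
      if m: "m \<in> A" for m
    proof -
      have "fps_deriv (g m X) * mono_eval m (jets Y) = (\<Sum>t\<in>-{i}. g' m t X * mono_eval (m + Poly_Mapping.single (t, 1) 1) (jets Y))"
        unfolding g'(2)[OF m X(1,2)] sum_distrib_right
        using X(3) by (intro sum.cong refl) (simp add: mono_eval_add mono_eval_single jets_def mult_ac)
      moreover have "g m X * fps_deriv (mono_eval m (jets Y)) =
        (\<Sum>v\<in>Poly_Mapping.keys m. fps_const (of_nat (Poly_Mapping.lookup m v)) * g m X *
         mono_eval (m - Poly_Mapping.single v 1 + Poly_Mapping.single (fst v, Suc (snd v)) 1) (jets Y))"
        unfolding fps_deriv_mono_eval sum_distrib_left
        by (intro sum.cong refl) (auto simp: mono_eval_add mono_eval_single jets_Suc mult_ac)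
      ultimately show ?thesis by simp
    qed
    then show ?thesis by (simp only: H_def G fps_deriv_sum cong: sum.cong)
  qed
  ultimately show ?thesis by (rule that[of H])
qed

lemma lifts_funpow_total_deriv:
  assumes "lifts i j P G"
  shows "\<exists>H. lifts i j ((total_deriv i ^^ l) P) H \<and>
    (\<forall>X Y. X i = 1 \<longrightarrow> fps_nth (X j) 0 \<noteq> 0 \<longrightarrow> (\<forall>t. t \<noteq> i \<longrightarrow> fps_deriv (X t) = fps_deriv (Y t)) \<longrightarrow>
       H X Y = (fps_deriv ^^ l) (G X Y))"
proof (induction l)
  case 0
  then show ?case using assms by auto
next
  case (Suc l)
  then obtain H where H: "lifts i j ((total_deriv i ^^ l) P) H"
    "\<And>X Y. X i = 1 \<Longrightarrow> fps_nth (X j) 0 \<noteq> 0 \<Longrightarrow> (\<forall>t. t \<noteq> i \<longrightarrow> fps_deriv (X t) = fps_deriv (Y t)) \<Longrightarrow>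
       H X Y = (fps_deriv ^^ l) (G X Y)"
    by blast
  obtain H' where "lifts i j (total_deriv i ((total_deriv i ^^ l) P)) H'"
    "\<And>X Y. X i = 1 \<Longrightarrow> fps_nth (X j) 0 \<noteq> 0 \<Longrightarrow> (\<And>t. t \<noteq> i \<Longrightarrow> fps_deriv (X t) = fps_deriv (Y t)) \<Longrightarrow>
       H' X Y = fps_deriv (H X Y)"
    using lifts_total_deriv[OF H(1)] by metis
  with H(2) show ?case by (intro exI[of _ H']) simp
qed

lemma lifts_eval:
  assumes "lifts i j P G" "x \<in> overlap i j" "\<And>t. fps_nth (X t) 0 = homog i x $ t"
  shows "fps_nth (G X Y) 0 = jeval P x (\<lambda>(t, l). fact l * fps_nth (Y t) l)"
proof -
  obtain A g where A: "finite A" "Poly_Mapping.keys P \<subseteq> A" and g: "\<And>m. m \<in> A \<Longrightarrow> lift i j (Poly_Mapping.lookup P m) (g m)"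
    and G: "G = (\<lambda>X Y. \<Sum>m\<in>A. g m X * mono_eval m (jets Y))"
    using assms(1) unfolding lifts_def by blast
  have "fps_nth (mono_eval m (jets Y)) 0 = mono_eval m (\<lambda>v. fps_nth (jets Y v) 0)" for m
  proof -
    have "fps_nth (\<Prod>v\<in>K. jets Y v ^ n v) 0 = (\<Prod>v\<in>K. fps_nth (jets Y v) 0 ^ n v)"
      for n and K :: "('a \<times> nat) set"
      by (induction K rule: infinite_finite_induct) (simp_all add: fps_nth_power_0)
    then show ?thesis by (simp add: mono_eval_def)
  qed
  moreover have "(\<lambda>v. fps_nth (jets Y v) 0) = (\<lambda>(t, l). fact l * fps_nth (Y t) l)"
    by (auto simp: jets_nth_0)
  ultimately show ?thesis
    unfolding jeval_superset[OF A] G fps_sum_nth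
    using lift_eval[OF g assms(2,3)] by (intro sum.cong refl) simp
qed

text \<open>The curve with the prescribed point and jets; the division by \<open>fact l\<close>
  turns derivatives into Taylor coefficients.\<close>

definition curve :: "'n \<Rightarrow> complex ^ 'n::finite \<Rightarrow> ('n \<times> nat \<Rightarrow> complex) \<Rightarrow> 'n \<Rightarrow> complex fps" where
  "curve i x y t = (if t = i then 1 else Abs_fps (\<lambda>l. if l = 0 then x $ t else y (t, l) / fact l))"

text \<open>The formal derivatives of the transition components, evaluated on a curve, are the
  derivatives of the quotients X_t / X_j at the origin.\<close>

lemma jeval_chart_change:
  assumes x: "x \<in> overlap i j"
  shows "jeval (chart_change i j P) x y =
    jeval P (transition i j x) (\<lambda>(t, l). fact l * fps_nth (curve i x y t * inverse (curve i x y j)) l)"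
proof -
  let ?X = "curve i x y"
  let ?f = "\<lambda>t x. transition i j x $ t"
  \<comment> \<open>Unlike \<open>?X\<close>, this curve keeps \<open>y (t, 0)\<close> and the slot
    \<open>i\<close>, so its jets reproduce all of \<open>y\<close>.\<close>
  let ?Y = "\<lambda>t. Abs_fps (\<lambda>l. y (t, l) / fact l)"
  have X: "fps_nth (?X t) 0 = homog i x $ t" for t
    by (simp add: curve_def homog_nth)
  have Xi: "?X i = 1" by (simp add: curve_def)
  have Xj: "fps_nth (?X j) 0 \<noteq> 0" using x by (simp add: X overlap_def)
  have XY: "fps_deriv (?X t) = fps_deriv (?Y t)" if "t \<noteq> i" for t
    using that by (simp add: curve_def fps_eq_iff)
  have *: "jeval ((total_deriv i ^^ l) (coeff_poly (?f t))) x y = fact l * fps_nth (?X t * inverse (?X j)) l" for t l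
  proof -
    have "lift i j (?f t) (\<lambda>X. X t * inverse (X j))"
      by (rule lift_mult[OF lift_coord[OF refl] lift_inverse[OF refl]]) (simp add: transition_def divide_inverse)
    then have "lifts i j (coeff_poly (?f t)) (\<lambda>X Y. X t * inverse (X j) * mono_eval 0 (jets Y))"
      unfolding coeff_poly_def by (rule lifts_single)
    from lifts_funpow_total_deriv[OF this, of l]
    obtain H where H: "lifts i j ((total_deriv i ^^ l) (coeff_poly (?f t))) H"
      and "\<forall>X Y. X i = 1 \<longrightarrow> fps_nth (X j) 0 \<noteq> 0 \<longrightarrow> (\<forall>t. t \<noteq> i \<longrightarrow> fps_deriv (X t) = fps_deriv (Y t)) \<longrightarrow>
        H X Y = (fps_deriv ^^ l) (X t * inverse (X j) * mono_eval 0 (jets Y))"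
      by (elim exE conjE)
    then have H': "H ?X ?Y = (fps_deriv ^^ l) (?X t * inverse (?X j) * mono_eval 0 (jets ?Y))"
      by (elim allE[of _ ?X] allE[of _ ?Y] impE) (simp_all add: Xi Xj XY)
    have "jeval ((total_deriv i ^^ l) (coeff_poly (?f t))) x (\<lambda>(t, l). fact l * fps_nth (?Y t) l) =
        fps_nth (H ?X ?Y) 0"
      using lifts_eval[OF H x X] by simp
    moreover have "(\<lambda>(t, l). fact l * fps_nth (?Y t) l) = y" by auto
    ultimately show ?thesis by (simp add: H' mono_eval_0 fps_nth_funpow_deriv)
  qed
  show ?thesis
    unfolding chart_change_def jeval_sum jeval_mult jeval_coeff_poly jeval_prod case_prod_unfold jeval_power *
    by (simp add: jeval_def mono_eval_def case_prod_unfold)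
qed

section \<open>From covariant functionals to sections\<close>

definition GG_jet_vars :: "nat \<Rightarrow> 'n \<Rightarrow> ('n \<times> nat) set" where
  "GG_jet_vars k i = {(t, l). t \<noteq> i \<and> 1 \<le> l \<and> l \<le> k}"

text \<open>Grouping the monomials by weight recovers the direct sum, so the weights can be
  forgotten afterwards.\<close>

lemma GG_sum_chart_iff:
  "P \<in> GG_sum_chart k i \<longleftrightarrow>
    (\<forall>m. chart_function i (Poly_Mapping.lookup P m)) \<and>
    (\<forall>m\<in>Poly_Mapping.keys P. Poly_Mapping.keys m \<subseteq> GG_jet_vars k i)" (is "_ \<longleftrightarrow> ?R P")
proof
  assume "P \<in> GG_sum_chart k i"
  then obtain M p where p: "P = (\<Sum>n<M. p n)" "\<And>n. n < M \<Longrightarrow> p n \<in> GG_chart k n i"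
    unfolding GG_sum_chart_def by blast
  have R: "?R (p n)" if "n < M" for n
  proof -
    have "chart_function i (Poly_Mapping.lookup (p n) m)" for m
      using p(2)[OF that] chart_function_zero[of i]
      by (cases "m \<in> Poly_Mapping.keys (p n)") (auto simp: GG_chart_def in_keys_iff)
    then show ?thesis using p(2)[OF that] by (auto simp: GG_chart_def GG_jet_vars_def)
  qed
  have add: "?R (Q + Q')" if "?R Q" "?R Q'" for Q Q'
  proof -
    have "chart_function i (Poly_Mapping.lookup (Q + Q') m)" for m
      using that by (simp add: lookup_add chart_function_add)
    then show ?thesis using that Poly_Mapping.keys_add[of Q Q'] by blast
  qed
  have "?R (\<Sum>n<L. p n)" if "L \<le> M" for L
    using that
  proof (induction L)
    case (Suc L)
    then show ?case unfolding sum.lessThan_Suc by (intro add R) auto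
  qed (simp add: chart_function_zero)
  then show "?R P" using p(1) by blast
next
  assume R: "?R P"
  define p where "p n = (\<Sum>m\<in>{m\<in>Poly_Mapping.keys P. jet_weight m = n}. Poly_Mapping.single m (Poly_Mapping.lookup P m))" for n
  \<comment> \<open>A single weight is at most the sum of all weights, so this bounds every index
    that occurs.\<close>
  define M where "M = Suc (\<Sum>m\<in>Poly_Mapping.keys P. jet_weight m)"
  have M: "jet_weight m < M" if "m \<in> Poly_Mapping.keys P" for m
    using member_le_sum[of m "Poly_Mapping.keys P" jet_weight] that by (simp add: M_def)
  have "P = (\<Sum>m\<in>Poly_Mapping.keys P. Poly_Mapping.single m (Poly_Mapping.lookup P m))"
    by (rule poly_mapping_sum_single)
  also have "\<dots> = (\<Sum>n<M. p n)"
    unfolding p_def by (rule sum.group[symmetric]) (use M in auto)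
  finally have P: "P = (\<Sum>n<M. p n)" .
  have "p n \<in> GG_chart k n i" for n
  proof -
    have "Poly_Mapping.lookup (p n) m = (if m \<in> Poly_Mapping.keys P \<and> jet_weight m = n then Poly_Mapping.lookup P m else 0)" for m
      unfolding p_def lookup_sum by (simp add: lookup_single when_def sum.delta')
    then show ?thesis
      using R by (auto simp: GG_chart_def GG_jet_vars_def in_keys_iff split: if_splits)
  qed
  with P show "P \<in> GG_sum_chart k i" unfolding GG_sum_chart_def by blast
qed

lemma chart_function_const: "chart_function i (\<lambda>_. c)"
  by (auto simp: chart_function_def holomorphic_several_def intro!: exI[of _ "\<lambda>_. 0"])

lemma chart_function_coord:
  assumes "t \<noteq> i" shows "chart_function i (\<lambda>x. x $ t)"
proof -
  have "((\<lambda>x. x $ t) has_derivative (\<lambda>v. v $ t)) (at x)" for x :: "complex ^ 'a"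
    by (rule bounded_linear_imp_has_derivative[OF bounded_linear_vec_nth])
  then show ?thesis
    using assms by (auto simp: chart_function_def holomorphic_several_def homog_nth intro!: exI[of _ "\<lambda>v. v $ t"])
qed

lemma chart_function_mult:
  assumes "chart_function i f" "chart_function i g"
  shows "chart_function i (f * g)"
  unfolding chart_function_def holomorphic_several_def
proof (intro conjI ballI allI)
  fix x
  from assms obtain f' g' where
    f: "(f has_derivative f') (at x)" "\<forall>c v. f' (c *s v) = c * f' v" and
    g: "(g has_derivative g') (at x)" "\<forall>c v. g' (c *s v) = c * g' v"
    unfolding chart_function_def holomorphic_several_def by blast
  have "((f * g) has_derivative (\<lambda>h. f x * g' h + f' h * g x)) (at x)"
    using has_derivative_mult[OF f(1) g(1)] by (simp add: times_fun_def)
  moreover have "f x * g' (c *s v) + f' (c *s v) * g x = c * (f x * g' v + f' v * g x)" for c v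
    by (simp add: f(2) g(2) algebra_simps)
  ultimately show "\<exists>h. ((f * g) has_derivative h) (at x) \<and> (\<forall>c v. h (c *s v) = c * h v)" by blast
next
  show "(f * g) (homog i x) = (f * g) x" for x
    using assms by (simp add: chart_function_def)
qed

lemma GG_sum_chart_single:
  assumes "chart_function i f" "Poly_Mapping.keys m \<subseteq> GG_jet_vars k i"
  shows "Poly_Mapping.single m f \<in> GG_sum_chart k i"
  using assms chart_function_zero[of i]
  by (auto simp: GG_sum_chart_iff lookup_single when_def split: if_splits)

lemma GG_sum_chart_sum:
  "finite A \<Longrightarrow> (\<And>a. a \<in> A \<Longrightarrow> P a \<in> GG_sum_chart k i) \<Longrightarrow> (\<Sum>a\<in>A. P a) \<in> GG_sum_chart k i"
  by (induction A rule: finite_induct) (simp_all add: GG_sum_chart_zero GG_sum_chart_add)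

lemma GG_sum_chart_mult:
  assumes "P \<in> GG_sum_chart k i" "Q \<in> GG_sum_chart k i"
  shows "P * Q \<in> GG_sum_chart k i"
  unfolding poly_mapping_mult_sum_single[of P Q]
proof (intro GG_sum_chart_sum GG_sum_chart_single chart_function_mult finite_keys)
  fix m m' assume "m \<in> Poly_Mapping.keys P" "m' \<in> Poly_Mapping.keys Q"
  then show "chart_function i (Poly_Mapping.lookup P m)" "chart_function i (Poly_Mapping.lookup Q m')"
    "Poly_Mapping.keys (m + m') \<subseteq> GG_jet_vars k i"
    using assms Poly_Mapping.keys_add[of m m'] unfolding GG_sum_chart_iff by blast+
qed

text \<open>On a normalised curve, a Taylor coefficient is a constant, a chart coordinate, or a jet
  variable divided by a factorial.\<close>

lemma polyfun_chart_poly: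
  assumes "P \<in> polyfun k"
  shows "\<exists>S\<in>GG_sum_chart k i. \<forall>x y. jeval S x y = P (curve i x y)"
  using assms
proof induction
  case (polyfun_const c)
  have "coeff_poly (\<lambda>_. c) \<in> GG_sum_chart k i"
    unfolding coeff_poly_def by (intro GG_sum_chart_single chart_function_const) simp
  then show ?case by (rule bexI[rotated]) (simp add: jeval_coeff_poly)
next
  case (polyfun_var l t)
  show ?case
  proof (cases "t = i \<or> l = 0")
    case True
    define f where "f = (\<lambda>x :: complex ^ 'a. if t = i then if l = 0 then 1 else 0 else x $ t)"
    have "chart_function i f"
      unfolding f_def by (cases "t = i"; cases "l = 0") (simp_all add: chart_function_coord chart_function_const)
    then have "coeff_poly f \<in> GG_sum_chart k i"
      unfolding coeff_poly_def by (rule GG_sum_chart_single) simp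
    with True show ?thesis
      by (intro bexI[of _ "coeff_poly f"]) (auto simp: jeval_coeff_poly curve_def f_def)
  next
    case False
    define S where "S = Poly_Mapping.single (Poly_Mapping.single (t, l) (1 :: nat)) (\<lambda>_ :: complex ^ 'a. 1 / fact l :: complex)"
    have "S \<in> GG_sum_chart k i"
      unfolding S_def using False polyfun_var
      by (intro GG_sum_chart_single chart_function_const) (auto simp: GG_jet_vars_def)
    with False show ?thesis
      by (intro bexI[of _ S]) (auto simp: S_def jeval_single mono_eval_single curve_def)
  qed
next
  case (polyfun_add P Q)
  then obtain S T where "S \<in> GG_sum_chart k i" "\<forall>x y. jeval S x y = P (curve i x y)"
    "T \<in> GG_sum_chart k i" "\<forall>x y. jeval T x y = Q (curve i x y)" by blast
  then show ?case by (intro bexI[of _ "S + T"] GG_sum_chart_add) (auto simp: jeval_add)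
next
  case (polyfun_mult P Q)
  then obtain S T where "S \<in> GG_sum_chart k i" "\<forall>x y. jeval S x y = P (curve i x y)"
    "T \<in> GG_sum_chart k i" "\<forall>x y. jeval T x y = Q (curve i x y)" by blast
  then show ?case by (intro bexI[of _ "S * T"] GG_sum_chart_mult) (auto simp: jeval_mult)
qed

lemma curve_nth_0: "fps_nth (curve i x y t) 0 = homog i x $ t"
  by (simp add: curve_def homog_nth)

text \<open>Rescaling a curve so that its coordinate \<open>j\<close> becomes \<open>1\<close> amounts to the change of charts.\<close>

lemma curve_transition:
  assumes "x \<in> overlap i j"
  shows "curve j (transition i j x) (\<lambda>(t, l). fact l * fps_nth (curve i x y t * inverse (curve i x y j)) l) =
    (\<lambda>t. curve i x y t * inverse (curve i x y j))"
proof
  fix t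
  have j: "fps_nth (curve i x y j) 0 \<noteq> 0" using assms by (simp add: curve_nth_0 overlap_def)
  show "curve j (transition i j x) (\<lambda>(t, l). fact l * fps_nth (curve i x y t * inverse (curve i x y j)) l) t =
    curve i x y t * inverse (curve i x y j)"
  proof (cases "t = j")
    case True
    then show ?thesis using inverse_mult_eq_1'[OF j] by (simp add: curve_def)
  next
    case False
    then show ?thesis
      by (subst curve_def) (auto simp: fps_eq_iff transition_def curve_nth_0 divide_inverse)
  qed
qed

lemma covariant_section:
  assumes "P \<in> covariant k d"
  obtains S where "S \<in> GG_global_sections k d" "\<And>i x y. jeval (S i) x y = P (curve i x y)"
proof -
  have P: "P \<in> polyfun k" using assms by (simp add: covariant_def)
  obtain S where S: "\<And>i. S i \<in> GG_sum_chart k i" "\<And>i x y. jeval (S i) x y = P (curve i x y)"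
    using polyfun_chart_poly[OF P] by metis
  have "Poly_Mapping.lookup (S i) m x = (homog i x $ j) ^ d * Poly_Mapping.lookup (chart_change i j (S j)) m x"
    if x: "x \<in> overlap i j" for i j m x
  proof -
    have "1 * Poly_Mapping.lookup (S i) m x = (homog i x $ j) ^ d * Poly_Mapping.lookup (chart_change i j (S j)) m x"
    proof (rule lookup_eq_of_jeval_eq)
      fix y
      let ?X = "curve i x y"
      have j: "fps_nth (?X j) 0 = homog i x $ j" "homog i x $ j \<noteq> 0"
        using x by (auto simp: curve_nth_0 overlap_def)
      have "jeval (chart_change i j (S j)) x y = P (\<lambda>t. inverse (?X j) * ?X t)"
        unfolding jeval_chart_change[OF x] S(2) curve_transition[OF x] by (simp add: mult.commute)
      \<comment> \<open>This is covariance under the unit \<open>inverse (?X j)\<close>; its degree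
        cancels the twisting factor.\<close>
      also have "\<dots> = inverse (homog i x $ j) ^ d * P ?X"
        using assms j by (simp add: covariant_def)
      finally show "1 * jeval (S i) x y = (homog i x $ j) ^ d * jeval (chart_change i j (S j)) x y"
        using j by (simp add: S(2) flip: power_mult_distrib mult.assoc)
    qed
    then show ?thesis by simp
  qed
  then have "S \<in> GG_global_sections k d"
    using S(1) by (simp add: GG_global_sections_def)
  then show ?thesis using that S(2) by blast
qed

lemma continuous_slice: "continuous_on UNIV (slice t x)"
proof -
  have "continuous_on UNIV (\<lambda>z. if m = t then z else x $ m)" for m
    by (cases "m = t") simp_all
  then show ?thesis unfolding slice_def by (rule continuous_on_vec_lambda)
qed

lemma chart_function_continuous:
  assumes "chart_function i f" shows "continuous_on UNIV f"
  using assms unfolding chart_function_def holomorphic_several_def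
  by (meson continuous_at_imp_continuous_on has_derivative_continuous)

text \<open>In any chart \<open>U_j\<close> the section vanishes on the overlap with
  \<open>U_i\<close>, and varying coordinate \<open>i\<close> extends this across X_i = 0 by
  continuity.\<close>

lemma section_eq_0:
  assumes s: "s \<in> GG_global_sections k d" and 0: "\<And>x y. jeval (s i) x y = 0"
  shows "s = 0"
proof
  fix j
  have si: "s i = 0"
  proof (rule poly_mapping_eqI)
    show "Poly_Mapping.lookup (s i) m = Poly_Mapping.lookup 0 m" for m
      using lookup_eq_of_jeval_eq[of 1 "s i" _ 1 0 _ m] 0 by (simp add: fun_eq_iff)
  qed
  have "Poly_Mapping.lookup (s j) m x = 0" for m x
  proof -
    have *: "Poly_Mapping.lookup (s j) m x = 0" if "x \<in> overlap j i" for x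
      using s that by (simp add: GG_global_sections_def si chart_change_zero)
    have c: "continuous_on UNIV (\<lambda>z. Poly_Mapping.lookup (s j) m (slice i x z))"
    proof -
      have "chart_function j (Poly_Mapping.lookup (s j) m)"
        using s by (simp add: GG_global_sections_def GG_sum_chart_iff)
      then have "continuous_on UNIV (Poly_Mapping.lookup (s j) m)"
        by (rule chart_function_continuous)
      moreover have "continuous_on UNIV (\<lambda>z. slice i x z)"
        by (rule continuous_slice)
      ultimately show ?thesis by (rule continuous_on_compose2) auto
    qed
    show ?thesis
    proof (cases "x \<in> overlap j i")
      case False
      then have "i \<noteq> j" "x $ i = 0" by (auto simp: overlap_def homog_nth split: if_splits)
      have "Poly_Mapping.lookup (s j) m (slice i x 0) = 0"
        by (rule continuous_eq_at_zero[OF c, of "\<lambda>_. 0"])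
          (use \<open>i \<noteq> j\<close> in \<open>auto intro!: * simp: overlap_def homog_nth slice_def\<close>)
      then show ?thesis using \<open>x $ i = 0\<close> slice_self[of i x] by simp
    qed (rule *)
  qed
  then show "s j = 0 j" by (simp add: poly_mapping_eq_iff fun_eq_iff)
qed

section \<open>From sections to covariant functionals\<close>

lemma fps_inverse_nth_Suc:
  fixes U :: "complex fps"
  assumes "fps_nth U 0 \<noteq> 0"
  shows "fps_nth (inverse U) (Suc n) = - inverse (fps_nth U 0) * (\<Sum>a\<le>n. fps_nth (inverse U) a * fps_nth U (Suc n - a))"
proof -
  have "0 = fps_nth (inverse U * U) (Suc n)"
    by (simp add: inverse_mult_eq_1[OF assms])
  also have "\<dots> = (\<Sum>a\<le>n. fps_nth (inverse U) a * fps_nth U (Suc n - a)) + fps_nth (inverse U) (Suc n) * fps_nth U 0"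
    by (simp add: fps_mult_nth atLeast0AtMost)
  finally show ?thesis
    using assms by (simp add: field_simps add_eq_0_iff2 add_eq_0_iff)
qed

lemma continuous_on_fps_inverse:
  fixes U :: "complex \<Rightarrow> complex fps"
  assumes "\<And>l. continuous_on S (\<lambda>z. fps_nth (U z) l)" "\<And>z. z \<in> S \<Longrightarrow> fps_nth (U z) 0 \<noteq> 0"
  shows "continuous_on S (\<lambda>z. fps_nth (inverse (U z)) l)"
proof (induction l rule: less_induct)
  case (less l)
  show ?case
  proof (cases l)
    case 0
    then show ?thesis using assms by (auto intro!: continuous_intros)
  next
    case (Suc n)
    have "continuous_on S (\<lambda>z. - inverse (fps_nth (U z) 0) * (\<Sum>a\<le>n. fps_nth (inverse (U z)) a * fps_nth (U z) (Suc n - a)))"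
      using assms less Suc by (intro continuous_intros) auto
    moreover have "fps_nth (inverse (U z)) l = - inverse (fps_nth (U z) 0) * (\<Sum>a\<le>n. fps_nth (inverse (U z)) a * fps_nth (U z) (Suc n - a))"
      if "z \<in> S" for z
      unfolding Suc by (rule fps_inverse_nth_Suc[OF assms(2)[OF that]])
    ultimately show ?thesis by (subst continuous_on_cong[OF refl])
  qed
qed

lemma holomorphic_slice:
  assumes "chart_function i f"
  shows "(\<lambda>z. f (slice t x z)) holomorphic_on UNIV"
proof -
  have "\<exists>D. ((\<lambda>z. f (slice t x z)) has_field_derivative D) (at z)" for z
  proof -
    obtain f' where f': "(f has_derivative f') (at (slice t x z))" "\<And>c v. f' (c *s v) = c * f' v"
      using assms unfolding chart_function_def holomorphic_several_def by blast
    let ?e = "\<lambda>h :: complex. \<chi> m. if m = t then h else 0"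
    have "(slice t x has_derivative ?e) (at z)"
    proof -
      have "bounded_linear ?e"
        by (rule linear_conv_bounded_linear[THEN iffD1])
          (auto intro!: linearI simp: Finite_Cartesian_Product.vec_eq_iff)
      then have "((\<lambda>z. slice t x 0 + ?e z) has_derivative ?e) (at z)"
        by (auto intro!: derivative_eq_intros bounded_linear_imp_has_derivative)
      moreover have "(\<lambda>z. slice t x 0 + ?e z) = slice t x"
        by (auto simp: slice_def Finite_Cartesian_Product.vec_eq_iff fun_eq_iff)
      ultimately show ?thesis by simp
    qed
    from has_derivative_compose[OF this f'(1)]
    have "((\<lambda>z. f (slice t x z)) has_derivative (\<lambda>h. f' (?e h))) (at z)" .
    moreover have "f' (?e h) = f' (?e 1) * h" for h
    proof -
      have "?e h = h *s ?e 1" by (simp add: Finite_Cartesian_Product.vec_eq_iff)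
      then have "f' (?e h) = h * f' (?e 1)" using f'(2) by metis
      then show ?thesis by (simp add: mult.commute)
    qed
    then have "(\<lambda>h. f' (?e h)) = (*) (f' (?e 1))" by (rule ext)
    ultimately have "((\<lambda>z. f (slice t x z)) has_derivative (*) (f' (?e 1))) (at z)" by (simp only:)
    then show ?thesis unfolding has_field_derivative_def by blast
  qed
  then show ?thesis
    by (auto simp: holomorphic_on_def field_differentiable_def)
qed

lemma jeval_scale:
  assumes "\<And>m. Poly_Mapping.lookup P m x = c * Poly_Mapping.lookup Q m x'"
  shows "jeval P x y = c * jeval Q x' y"
proof -
  let ?A = "Poly_Mapping.keys P \<union> Poly_Mapping.keys Q"
  have "jeval P x y = (\<Sum>m\<in>?A. Poly_Mapping.lookup P m x * mono_eval m y)"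
    "jeval Q x' y = (\<Sum>m\<in>?A. Poly_Mapping.lookup Q m x' * mono_eval m y)"
    by (intro jeval_superset; auto)+
  then show ?thesis by (simp add: assms sum_distrib_left mult_ac)
qed

lemma section_transition:
  assumes "s \<in> GG_global_sections k d" "x \<in> overlap i j"
  shows "jeval (s i) x y = (homog i x $ j) ^ d * jeval (s j) (transition i j x)
    (\<lambda>(t, l). fact l * fps_nth (curve i x y t * inverse (curve i x y j)) l)"
  unfolding jeval_chart_change[OF assms(2), symmetric]
  using assms by (intro jeval_scale) (simp add: GG_global_sections_def)

lemma continuous_jeval:
  fixes f :: "'a::topological_space \<Rightarrow> complex ^ 'n::finite"
  assumes "S \<in> GG_sum_chart k i" "\<And>t. continuous_on A (\<lambda>w. f w $ t)" "\<And>v. continuous_on A (\<lambda>w. g w v)"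
  shows "continuous_on A (\<lambda>w. jeval S (f w) (g w))"
proof -
  have f: "continuous_on A f"
    using continuous_on_vec_lambda[of A "\<lambda>t w. f w $ t"] assms(2) by simp
  have "continuous_on UNIV (Poly_Mapping.lookup S m)" for m
    using assms(1) by (auto simp: GG_sum_chart_iff intro: chart_function_continuous)
  then have "continuous_on A (\<lambda>w. Poly_Mapping.lookup S m (f w))" for m
    by (rule continuous_on_compose2[OF _ f]) auto
  then show ?thesis
    unfolding jeval_def mono_eval_def by (intro continuous_intros assms(3))
qed

text \<open>As the coordinate \<open>z\<close> of index \<open>j\<close> tends to infinity, the section written in the chart \<open>U\<^sub>j\<close>
  depends continuously on \<open>1 / z\<close>, so its growth in the chart \<open>U\<^sub>i\<close> is that of the factor \<open>z ^ d\<close>.\<close>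

lemma section_slice_polynomial:
  assumes s: "s \<in> GG_global_sections k d" and ij: "i \<noteq> j"
  shows "\<exists>c. \<forall>z. jeval (s i) (slice j x z) y = (\<Sum>a\<le>d. c a * z ^ a)"
proof -
  define f where "f z = jeval (s i) (slice j x z) y" for z
  have S: "s i \<in> GG_sum_chart k i" for i using s by (simp add: GG_global_sections_def)
  have hol: "f holomorphic_on UNIV"
    unfolding f_def jeval_def using S
    by (intro holomorphic_intros holomorphic_slice[of i]) (auto simp: GG_sum_chart_iff)
  \<comment> \<open>With R the part of coordinate \<open>j\<close> without constant term and w = 1 /
    z, that coordinate is z \<open>U w\<close>. As \<open>U w\<close> is a unit even at w = 0, the
    rescaled curve \<open>E w\<close> extends continuously to infinity.\<close>
  define R where "R = Abs_fps (\<lambda>l. if l = 0 then 0 else y (j, l) / fact l)"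
  define U where "U w = 1 + fps_const w * R" for w
  have U0: "fps_nth (U w) 0 \<noteq> 0" for w by (simp add: U_def R_def)
  define E where "E w t = (if t = j then 1 else fps_const w * curve i x y t * inverse (U w))" for w t
  have E: "continuous_on UNIV (\<lambda>w. fps_nth (E w t) l)" for t l
  proof -
    have "continuous_on UNIV (\<lambda>w. fps_nth (inverse (U w)) l)" for l
    proof (rule continuous_on_fps_inverse[OF _ U0])
      show "continuous_on UNIV (\<lambda>w. fps_nth (U w) l)" for l
        unfolding U_def by (auto intro!: continuous_intros)
    qed
    then have "continuous_on UNIV (\<lambda>w. fps_nth (fps_const w * curve i x y t * inverse (U w)) l)"
      unfolding fps_mult_nth[of "_ * _"] by (auto intro!: continuous_intros)
    then show ?thesis by (cases "t = j") (simp_all add: E_def)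
  qed
  define B where "B w = jeval (s j) (\<chi> t. fps_nth (E w t) 0) (\<lambda>(t, l). fact l * fps_nth (E w t) l)" for w
  have "continuous_on UNIV B"
    unfolding B_def by (rule continuous_jeval[OF S]) (auto intro!: continuous_intros E simp: case_prod_unfold)
  \<comment> \<open>The unit disc in w corresponds to the points z of norm at least 1, including
    infinity.\<close>
  then have "compact (B ` cball 0 1)"
    by (intro compact_continuous_image compact_cball) (rule continuous_on_subset, auto)
  then have "bounded (B ` cball 0 1)" by (rule compact_imp_bounded)
  then obtain M where "\<forall>b\<in>B ` cball 0 1. norm b \<le> M" unfolding bounded_iff ..
  then have M: "norm (B w) \<le> M" if "w \<in> cball 0 1" for w using that by blast
  have fB: "f z = z ^ d * B (inverse z)" if "z \<noteq> 0" for z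
  proof -
    let ?x = "slice j x z"
    have x: "?x \<in> overlap i j" using that ij by (simp add: overlap_def homog_nth slice_def)
    have j: "curve i ?x y j = fps_const z * U (inverse z)"
      using that ij by (auto simp: curve_def slice_def fps_eq_iff U_def R_def distrib_left)
    have E': "curve i ?x y t * inverse (curve i ?x y j) = E (inverse z) t" for t
    proof (cases "t = j")
      case True
      then show ?thesis
        using inverse_mult_eq_1'[of "curve i ?x y j"] that U0 by (simp add: E_def j)
    next
      case False
      then have "curve i ?x y t = curve i x y t" by (simp add: curve_def slice_def fps_eq_iff)
      with False that show ?thesis
        by (simp add: E_def j fps_inverse_mult fps_const_inverse mult_ac)
    qed
    have "transition i j ?x = (\<chi> t. fps_nth (E (inverse z) t) 0)"
      unfolding E'[symmetric]
      by (simp add: Finite_Cartesian_Product.vec_eq_iff transition_def curve_nth_0 divide_inverse)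
    moreover have "homog i ?x $ j = z" using ij by (simp add: homog_nth slice_def)
    ultimately show ?thesis
      unfolding f_def B_def using section_transition[OF s x, of y] by (simp add: E')
  qed
  have bound: "norm (f z) \<le> M * norm z ^ d" if "1 \<le> norm z" for z
  proof -
    have "inverse z \<in> cball 0 1" using that by (simp add: norm_inverse inverse_le_1_iff)
    moreover have "z \<noteq> 0" using that by auto
    ultimately show ?thesis
      using mult_right_mono[OF M[of "inverse z"], of "norm z ^ d"] by (simp add: fB norm_mult norm_power mult.commute)
  qed
  have "f z = (\<Sum>a\<le>d. (deriv ^^ a) f 0 / fact a * z ^ a)" for z
    by (rule Liouville_polynomial[OF hol, of 1 M]) (rule bound)
  then show ?thesis
    unfolding f_def[symmetric] by (intro exI[of _ "\<lambda>a. (deriv ^^ a) f 0 / fact a"] allI)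
qed

section \<open>Polynomiality in all coordinates\<close>

text \<open>Lagrange interpolation at 0 to d, with \<open>L\<close> independent of \<open>c\<close>.
  It replaces coefficients, whose dependence on the other coordinates is unknown, by values at fixed
  nodes.\<close>

lemma polynomial_interpolation:
  "\<exists>L :: nat \<Rightarrow> complex poly. \<forall>c z.
    (\<Sum>b\<le>d. c b * z ^ b) = (\<Sum>a\<le>d. poly (L a) z * (\<Sum>b\<le>d. c b * of_nat a ^ b))"
proof -
  define L :: "nat \<Rightarrow> complex poly" where
    "L a = (\<Prod>b\<in>{..d} - {a}. [:- of_nat b / (of_nat a - of_nat b), 1 / (of_nat a - of_nat b):])" for a
  have deg: "degree (L a) \<le> d" if "a \<le> d" for a
  proof -
    have "degree (L a) \<le> (\<Sum>b\<in>{..d} - {a}. degree [:- of_nat b / (of_nat a - of_nat b), 1 / (of_nat a - of_nat b) :: complex:])"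
      unfolding L_def by (rule degree_prod_sum_le[unfolded o_def]) simp
    also have "\<dots> \<le> (\<Sum>b\<in>{..d} - {a}. 1)" by (intro sum_mono) simp
    also have "\<dots> = d" using that by simp
    finally show ?thesis .
  qed
  have L: "poly (L a) (of_nat b) = (if a = b then 1 else 0)" if "a \<le> d" "b \<le> d" for a b
  proof (cases "a = b")
    case True
    have "- u / (v - u) + v * (1 / (v - u)) = 1" if "v \<noteq> u" for u v :: complex
      using that by (simp add: divide_simps)
    with True show ?thesis by (auto simp: L_def poly_prod intro!: prod.neutral)
  next
    case False
    then show ?thesis using that by (auto simp: L_def poly_prod prod_zero_iff)
  qed
  have "(\<Sum>b\<le>d. c b * z ^ b) = (\<Sum>a\<le>d. poly (L a) z * (\<Sum>b\<le>d. c b * of_nat a ^ b))" for c z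
  proof -
    define p where "p = (\<Sum>b\<le>d. Polynomial.monom (c b) b)"
    have p: "poly p z = (\<Sum>b\<le>d. c b * z ^ b)" for z by (simp add: p_def poly_sum poly_monom)
    define q where "q = (\<Sum>a\<le>d. Polynomial.smult (poly p (of_nat a)) (L a))"
    have "p - q = 0"
    proof (rule ccontr)
      assume pq: "p - q \<noteq> 0"
      have "degree p \<le> d" unfolding p_def by (intro degree_sum_le) (auto intro: order_trans[OF degree_monom_le])
      moreover have "degree q \<le> d"
        unfolding q_def by (intro degree_sum_le) (auto intro!: order_trans[OF degree_smult_le] deg)
      ultimately have "degree (p - q) \<le> d" by (rule degree_diff_le)
      moreover have "of_nat ` {..d} \<subseteq> {z. poly (p - q) z = 0}"
      proof safe
        fix b assume "b \<le> d"
        then have "poly q (of_nat b) = (\<Sum>a\<le>d. if a = b then poly p (of_nat b) else 0)"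
          unfolding q_def poly_sum by (intro sum.cong) (auto simp: L)
        with \<open>b \<le> d\<close> show "poly (p - q) (of_nat b) = 0" by simp
      qed
      then have "card (of_nat ` {..d} :: complex set) \<le> card {z. poly (p - q) z = 0}"
        by (rule card_mono[OF poly_roots_finite[OF pq]])
      moreover have "card {z. poly (p - q) z = 0} \<le> degree (p - q)"
        by (rule card_poly_roots_bound[OF pq])
      moreover have "card (of_nat ` {..d} :: complex set) = Suc d"
        by (subst card_image) (auto simp: inj_on_def)
      ultimately show False by simp
    qed
    then have "poly p z = poly q z" by simp
    then show ?thesis
      by (simp add: q_def p poly_sum mult.commute)
  qed
  then show ?thesis by blast
qed

lemma jeval_cong_GG:
  assumes "S \<in> GG_sum_chart k i" "homog i x = homog i x'"
    "\<And>t l. t \<noteq> i \<Longrightarrow> 1 \<le> l \<Longrightarrow> l \<le> k \<Longrightarrow> y (t, l) = y' (t, l)"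
  shows "jeval S x y = jeval S x' y'"
  unfolding jeval_def
proof (rule sum.cong[OF refl])
  fix m assume m: "m \<in> Poly_Mapping.keys S"
  then have c: "chart_function i (Poly_Mapping.lookup S m)" and v: "Poly_Mapping.keys m \<subseteq> GG_jet_vars k i"
    using assms(1) by (auto simp: GG_sum_chart_iff)
  have "Poly_Mapping.lookup S m x = Poly_Mapping.lookup S m x'"
    using c assms(2) unfolding chart_function_def by metis
  moreover have "mono_eval m y = mono_eval m y'"
    unfolding mono_eval_def using v assms(3) by (intro prod.cong) (auto simp: GG_jet_vars_def)
  ultimately show "Poly_Mapping.lookup S m x * mono_eval m y = Poly_Mapping.lookup S m x' * mono_eval m y'"
    by simp
qed

lemma section_polyfun:
  assumes s: "s \<in> GG_global_sections k d"
  shows "\<exists>P\<in>polyfun k. \<forall>x y. jeval (s i) x y = P (curve i x y)"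
proof -
  have S: "s i \<in> GG_sum_chart k i" using s by (simp add: GG_global_sections_def)
  define J :: "('a \<Rightarrow> complex fps) \<Rightarrow> 'a \<times> nat \<Rightarrow> complex" where
    "J X = (\<lambda>(t, l). fact l * fps_nth (X t) l)" for X
  from polynomial_interpolation[of d] obtain L :: "nat \<Rightarrow> complex poly" where
    L: "\<And>c z. (\<Sum>b\<le>d. c b * z ^ b) = (\<Sum>a\<le>d. poly (L a) z * (\<Sum>b\<le>d. c b * of_nat a ^ b))"
    by blast
  \<comment> \<open>Coordinates in \<open>A\<close> vary with the curve and the others are frozen at
    \<open>x\<close>. The point \<open>x\<close> stays arbitrary because interpolation freezes
    coordinate \<open>j\<close> at each node in turn.\<close>
  have *: "(\<lambda>X. jeval (s i) (\<chi> t. if t \<in> A then fps_nth (X t) 0 else x $ t) (J X)) \<in> polyfun k"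
    if "finite A" "i \<notin> A" for A x
    using that
  proof (induction A arbitrary: x rule: finite_induct)
    case empty
    have "(\<lambda>X. mono_eval m (J X)) \<in> polyfun k" if "m \<in> Poly_Mapping.keys (s i)" for m
      unfolding mono_eval_def
    proof (intro polyfun_prod finite_keys polyfun_power)
      fix v assume "v \<in> Poly_Mapping.keys m"
      then have "v \<in> GG_jet_vars k i" using S that by (auto simp: GG_sum_chart_iff)
      then show "(\<lambda>X. J X v) \<in> polyfun k"
        by (auto simp: J_def GG_jet_vars_def intro: polyfun.intros)
    qed
    then show ?case
      unfolding jeval_def empty_iff if_False by (intro polyfun_sum finite_keys polyfun_mult polyfun_const)
  next
    case (insert j A)
    define g :: "('a \<Rightarrow> complex fps) \<Rightarrow> complex ^ 'a" where
      "g X = (\<chi> t. if t \<in> A then fps_nth (X t) 0 else x $ t)" for X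
    have g1: "(\<chi> t. if t \<in> insert j A then fps_nth (X t) 0 else x $ t) = slice j (g X) (fps_nth (X j) 0)" for X
      by (auto simp: g_def slice_def Finite_Cartesian_Product.vec_eq_iff)
    have g2: "slice j (g X) z = (\<chi> t. if t \<in> A then fps_nth (X t) 0 else slice j x z $ t)" for X z
      using insert.hyps by (auto simp: g_def slice_def Finite_Cartesian_Product.vec_eq_iff)
    have "jeval (s i) (slice j (g X) z) y = (\<Sum>a\<le>d. poly (L a) z * jeval (s i) (slice j (g X) (of_nat a)) y)" for X y z
    proof -
      have "i \<noteq> j" using insert.prems by auto
      from section_slice_polynomial[OF s this] obtain c
        where c: "\<And>z. jeval (s i) (slice j (g X) z) y = (\<Sum>a\<le>d. c a * z ^ a)" by blast
      show ?thesis unfolding c by (rule L)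
    qed
    then have "(\<lambda>X. jeval (s i) (slice j (g X) (fps_nth (X j) 0)) (J X)) =
        (\<lambda>X. \<Sum>a\<le>d. poly (L a) (fps_nth (X j) 0) * jeval (s i) (slice j (g X) (of_nat a)) (J X))"
      by (rule ext)
    moreover have "(\<lambda>X. \<Sum>a\<le>d. poly (L a) (fps_nth (X j) 0) * jeval (s i) (slice j (g X) (of_nat a)) (J X)) \<in> polyfun k"
    proof (intro polyfun_sum polyfun_mult finite_atMost)
      fix a
      show "(\<lambda>X. poly (L a) (fps_nth (X j) 0)) \<in> polyfun k"
        unfolding poly_altdef by (intro polyfun_sum polyfun_mult polyfun_const polyfun_power polyfun_var) auto
      show "(\<lambda>X. jeval (s i) (slice j (g X) (of_nat a)) (J X)) \<in> polyfun k"
        unfolding g2 using insert.prems by (intro insert.IH) simp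
    qed
    ultimately show ?case unfolding g1 by (simp only:)
  qed
  define P where "P X = jeval (s i) (\<chi> t. if t \<in> - {i} then fps_nth (X t) 0 else 0 $ t) (J X)" for X
  have "P \<in> polyfun k" unfolding P_def using *[of "- {i}" 0] by simp
  moreover have "jeval (s i) x y = P (curve i x y)" for x y
    unfolding P_def
    by (rule jeval_cong_GG[OF S])
      (auto simp: homog_def curve_def J_def Finite_Cartesian_Product.vec_eq_iff)
  ultimately show ?thesis by blast
qed

section \<open>Homogenising a section and removing its pole\<close>

text \<open>By the recursion for the inverse series, its coefficient of index \<open>l\<close> has a
  pole of order at most l + 1 in the constant term.\<close>

lemma polyfun_fps_inverse:
  "l \<le> k \<Longrightarrow> \<exists>Q. Q \<in> polyfun k \<and> (\<forall>X. fps_nth (X i) 0 \<noteq> 0 \<longrightarrow> fps_nth (X i) 0 ^ Suc l * fps_nth (inverse (X i)) l = Q X)"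
proof (induction l rule: less_induct)
  case (less l)
  show ?case
  proof (cases l)
    case 0
    then show ?thesis by (intro exI[of _ "\<lambda>_. 1"]) (simp add: polyfun_const)
  next
    case (Suc n)
    have "\<forall>a\<in>{..n}. \<exists>Q. Q \<in> polyfun k \<and> (\<forall>X. fps_nth (X i) 0 \<noteq> 0 \<longrightarrow> fps_nth (X i) 0 ^ Suc a * fps_nth (inverse (X i)) a = Q X)"
      using less Suc by auto
    from bchoice[OF this] obtain Q where Q: "\<And>a. a \<le> n \<Longrightarrow> Q a \<in> polyfun k"
      "\<And>a X. a \<le> n \<Longrightarrow> fps_nth (X i) 0 \<noteq> 0 \<Longrightarrow> fps_nth (X i) 0 ^ Suc a * fps_nth (inverse (X i)) a = Q a X"
      by fastforce
    define R where "R X = (\<Sum>a\<le>n. (- 1) * (fps_nth (X i) 0 ^ (n - a) * (Q a X * fps_nth (X i) (Suc n - a))))" for X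
    have "R \<in> polyfun k"
      unfolding R_def using Q less.prems Suc
      by (intro polyfun_sum polyfun_mult polyfun_const polyfun_power polyfun_var) auto
    moreover have "fps_nth (X i) 0 ^ Suc l * fps_nth (inverse (X i)) l = R X" if X: "fps_nth (X i) 0 \<noteq> 0" for X
    proof -
      have "fps_nth (X i) 0 ^ Suc l * fps_nth (inverse (X i)) l =
          (\<Sum>a\<le>n. (- 1) * (fps_nth (X i) 0 ^ Suc n * (fps_nth (inverse (X i)) a * fps_nth (X i) (Suc n - a))))"
      proof -
        have "u ^ Suc (Suc n) * (- inverse u * S) = (- 1) * (u ^ Suc n * S)" if "u \<noteq> 0" for u S :: complex
          using that by simp
        from this[OF X] show ?thesis
          unfolding Suc fps_inverse_nth_Suc[OF X] by (simp only: sum_distrib_left)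
      qed
      also have "\<dots> = R X"
        unfolding R_def
      proof (intro sum.cong refl)
        fix a assume "a \<in> {..n}"
        then have pow: "fps_nth (X i) 0 ^ Suc n = fps_nth (X i) 0 ^ (n - a) * fps_nth (X i) 0 ^ Suc a"
          by (simp flip: power_add)
        have Qa: "Q a X = fps_nth (X i) 0 ^ Suc a * fps_nth (inverse (X i)) a"
          using Q(2)[of a X, OF _ X] \<open>a \<in> {..n}\<close> by simp
        show "(- 1) * (fps_nth (X i) 0 ^ Suc n * (fps_nth (inverse (X i)) a * fps_nth (X i) (Suc n - a))) =
            (- 1) * (fps_nth (X i) 0 ^ (n - a) * (Q a X * fps_nth (X i) (Suc n - a)))"
          by (simp only: pow Qa mult_ac)
      qed
      finally show ?thesis .
    qed
    ultimately show ?thesis by blast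
  qed
qed

lemma polyfun_dehomogenize:
  assumes "P \<in> polyfun k"
  shows "\<exists>m. \<exists>Q\<in>polyfun k. \<forall>X. fps_nth (X i) 0 \<noteq> 0 \<longrightarrow> fps_nth (X i) 0 ^ m * P (\<lambda>t. X t * inverse (X i)) = Q X"
  using assms
proof induction
  case (polyfun_const c)
  show ?case by (intro exI[of _ 0] bexI[OF _ polyfun.polyfun_const[of c]]) simp
next
  case (polyfun_var l t)
  have "\<forall>a\<in>{0..l}. \<exists>Q. Q \<in> polyfun k \<and> (\<forall>X. fps_nth (X i) 0 \<noteq> 0 \<longrightarrow> fps_nth (X i) 0 ^ Suc a * fps_nth (inverse (X i)) a = Q X)"
    using polyfun_var by (intro ballI polyfun_fps_inverse) simp
  from bchoice[OF this] obtain Q where Q: "\<And>a. a \<le> l \<Longrightarrow> Q a \<in> polyfun k"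
    "\<And>a X. a \<le> l \<Longrightarrow> fps_nth (X i) 0 \<noteq> 0 \<Longrightarrow> fps_nth (X i) 0 ^ Suc a * fps_nth (inverse (X i)) a = Q a X"
    by fastforce
  define R where "R X = (\<Sum>a = 0..l. fps_nth (X t) a * (fps_nth (X i) 0 ^ a * Q (l - a) X))" for X
  have "R \<in> polyfun k"
    unfolding R_def using Q polyfun_var
    by (intro polyfun_sum polyfun_mult polyfun.polyfun_const polyfun_power polyfun.polyfun_var) auto
  moreover have "fps_nth (X i) 0 ^ Suc l * fps_nth (X t * inverse (X i)) l = R X" if X: "fps_nth (X i) 0 \<noteq> 0" for X
    unfolding R_def fps_mult_nth sum_distrib_left
  proof (intro sum.cong refl)
    fix a assume a: "a \<in> {0..l}"
    then have pow: "fps_nth (X i) 0 ^ Suc l = fps_nth (X i) 0 ^ a * fps_nth (X i) 0 ^ Suc (l - a)"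
      by (simp flip: power_add)
    have Qa: "Q (l - a) X = fps_nth (X i) 0 ^ Suc (l - a) * fps_nth (inverse (X i)) (l - a)"
      using Q(2)[of "l - a" X, OF _ X] by simp
    show "fps_nth (X i) 0 ^ Suc l * (fps_nth (X t) a * fps_nth (inverse (X i)) (l - a)) =
        fps_nth (X t) a * (fps_nth (X i) 0 ^ a * Q (l - a) X)"
      by (simp only: pow Qa mult_ac)
  qed
  ultimately show ?case by blast
next
  case (polyfun_add P P')
  then obtain m Q m' Q' where Q: "Q \<in> polyfun k" "Q' \<in> polyfun k"
    "\<And>X. fps_nth (X i) 0 \<noteq> 0 \<Longrightarrow> fps_nth (X i) 0 ^ m * P (\<lambda>t. X t * inverse (X i)) = Q X"
    "\<And>X. fps_nth (X i) 0 \<noteq> 0 \<Longrightarrow> fps_nth (X i) 0 ^ m' * P' (\<lambda>t. X t * inverse (X i)) = Q' X"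
    by blast
  have c1: "(\<lambda>X. fps_nth (X i) 0 ^ m' * Q X + fps_nth (X i) 0 ^ m * Q' X) \<in> polyfun k"
    by (intro polyfun.polyfun_add polyfun_mult polyfun_power polyfun_var Q(1,2)) simp_all
  have c2: "fps_nth (X i) 0 ^ (m + m') * (P (\<lambda>t. X t * inverse (X i)) + P' (\<lambda>t. X t * inverse (X i))) =
     fps_nth (X i) 0 ^ m' * Q X + fps_nth (X i) 0 ^ m * Q' X" if "fps_nth (X i) 0 \<noteq> 0" for X
    using Q(3)[of X, OF that, symmetric] Q(4)[of X, OF that, symmetric] by (simp add: power_add algebra_simps)
  show ?case by (intro exI[of _ "m + m'"] bexI[OF _ c1] allI impI) (rule c2)
next
  case (polyfun_mult P P')
  then obtain m Q m' Q' where Q: "Q \<in> polyfun k" "Q' \<in> polyfun k"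
    "\<And>X. fps_nth (X i) 0 \<noteq> 0 \<Longrightarrow> fps_nth (X i) 0 ^ m * P (\<lambda>t. X t * inverse (X i)) = Q X"
    "\<And>X. fps_nth (X i) 0 \<noteq> 0 \<Longrightarrow> fps_nth (X i) 0 ^ m' * P' (\<lambda>t. X t * inverse (X i)) = Q' X"
    by blast
  have c1: "(\<lambda>X. Q X * Q' X) \<in> polyfun k"
    by (intro polyfun.polyfun_mult Q(1,2))
  have c2: "fps_nth (X i) 0 ^ (m + m') * (P (\<lambda>t. X t * inverse (X i)) * P' (\<lambda>t. X t * inverse (X i))) = Q X * Q' X"
    if "fps_nth (X i) 0 \<noteq> 0" for X
    using Q(3)[of X, OF that, symmetric] Q(4)[of X, OF that, symmetric] by (simp add: power_add algebra_simps)
  show ?case by (intro exI[of _ "m + m'"] bexI[OF _ c1] allI impI) (rule c2)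
qed

text \<open>X_i(0) and X_j(0) are different variables: setting the first to 0 leaves the second
  free, so it can be cancelled, and \<open>A\<close> vanishes there. One factor X_i(0) is split off
  at a time.\<close>

lemma polyfun_coprime_divide:
  assumes "i \<noteq> j" "A \<in> polyfun k" "B \<in> polyfun k"
    "\<And>X. fps_nth (X j) 0 ^ n * A X = fps_nth (X i) 0 ^ m * B X"
  shows "\<exists>P\<in>polyfun k. \<forall>X. A X = fps_nth (X i) 0 ^ m * P X"
  using assms(2,4)
proof (induction m arbitrary: A)
  case 0
  then show ?case by auto
next
  case (Suc m)
  have A0: "A (set_coeff0 i 0 X) = 0" for X
  proof (rule polyfun_cancel[of "\<lambda>X. A (set_coeff0 i 0 X)" k "\<lambda>_. 0" j n])
    show "(\<lambda>X. A (set_coeff0 i 0 X)) \<in> polyfun k"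
      by (rule polyfun_set_coeff0[OF Suc.prems(1)])
    show "fps_nth (X j) 0 ^ n * A (set_coeff0 i 0 X) = fps_nth (X j) 0 ^ n * 0" for X
      using Suc.prems(2)[of "set_coeff0 i 0 X"] assms(1) by (auto simp: nth_set_coeff0)
  qed (rule polyfun_const)
  have "A X = 0" if "fps_nth (X i) 0 = 0" for X
    using A0[of X] set_coeff0_ident[of i X] that by simp
  then obtain A1 where A1: "A1 \<in> polyfun k" "\<And>X. A X = fps_nth (X i) 0 * A1 X"
    using polyfun_divideE[OF Suc.prems(1)] by metis
  have "fps_nth (X j) 0 ^ n * A1 X = fps_nth (X i) 0 ^ m * B X" for X
  proof (rule polyfun_cancel[of "\<lambda>X. fps_nth (X j) 0 ^ n * A1 X" k "\<lambda>X. fps_nth (X i) 0 ^ m * B X" i 1])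
    show "(\<lambda>X. fps_nth (X j) 0 ^ n * A1 X) \<in> polyfun k" "(\<lambda>X. fps_nth (X i) 0 ^ m * B X) \<in> polyfun k"
      by (intro polyfun_mult polyfun_power polyfun_var A1(1) assms(3); simp)+
    show "fps_nth (X i) 0 ^ 1 * (fps_nth (X j) 0 ^ n * A1 X) = fps_nth (X i) 0 ^ 1 * (fps_nth (X i) 0 ^ m * B X)" for X
      using Suc.prems(2)[of X] by (simp add: A1(2) mult_ac)
  qed
  from Suc.IH[OF A1(1) this] obtain P where "P \<in> polyfun k" "\<forall>X. A1 X = fps_nth (X i) 0 ^ m * P X" by blast
  then show ?case by (intro bexI[of _ P]) (auto simp: A1(2))
qed

lemma curve_jets:
  assumes "X i = 1"
  shows "curve i (\<chi> t. fps_nth (X t) 0) (\<lambda>(t, l). fact l * fps_nth (X t) l) = X"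
  using assms by (auto simp: curve_def fun_eq_iff fps_eq_iff)

text \<open>The transition rule says that the degree-d homogenisations from two charts agree
  wherever both are defined.\<close>

lemma section_homogeneous_eq:
  assumes s: "s \<in> GG_global_sections k d"
    and Hi: "\<And>x y. jeval (s i) x y = Hi (curve i x y)" and Hj: "\<And>x y. jeval (s j) x y = Hj (curve j x y)"
    and X: "fps_nth (X i) 0 \<noteq> 0" "fps_nth (X j) 0 \<noteq> 0"
  shows "fps_nth (X i) 0 ^ d * Hi (\<lambda>t. X t * inverse (X i)) = fps_nth (X j) 0 ^ d * Hj (\<lambda>t. X t * inverse (X j))"
proof -
  define C where "C t = X t * inverse (X i)" for t
  define x where "x = (\<chi> t. fps_nth (C t) 0)"
  define y where "y = (\<lambda>(t, l). fact l * fps_nth (C t) l)"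
  have Ci: "C i = 1" unfolding C_def by (rule inverse_mult_eq_1'[OF X(1)])
  have C: "curve i x y = C" unfolding x_def y_def by (rule curve_jets[where i = i and X = C, OF Ci])
  have Cj: "homog i x $ j = fps_nth (X j) 0 / fps_nth (X i) 0"
    unfolding curve_nth_0[of i x y, symmetric] C by (simp add: C_def divide_inverse)
  have ov: "x \<in> overlap i j" using X by (simp add: overlap_def Cj)
  have "C t * inverse (C j) = X t * inverse (X j)" for t
  proof -
    have "C t * inverse (C j) = X t * inverse (X j) * (X i * inverse (X i))"
      using X by (simp add: C_def fps_inverse_mult fps_inverse_idempotent mult_ac)
    then show ?thesis by (simp add: inverse_mult_eq_1'[OF X(1)])
  qed
  then have "(\<lambda>t. C t * inverse (C j)) = (\<lambda>t. X t * inverse (X j))" by (rule ext)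
  moreover have "jeval (s i) x y = (homog i x $ j) ^ d * Hj (\<lambda>t. curve i x y t * inverse (curve i x y j))"
    unfolding section_transition[OF s ov] Hj curve_transition[OF ov] ..
  ultimately have "jeval (s i) x y = (homog i x $ j) ^ d * Hj (\<lambda>t. X t * inverse (X j))"
    by (simp only: C)
  moreover have "jeval (s i) x y = Hi (\<lambda>t. X t * inverse (X i))"
    unfolding Hi C by (simp add: C_def[abs_def])
  ultimately show ?thesis using X by (simp add: Cj power_divide)
qed

lemma section_covariant:
  assumes s: "s \<in> GG_global_sections k d" and ij: "i \<noteq> j"
  shows "\<exists>P\<in>covariant k d. \<forall>x y. jeval (s i) x y = P (curve i x y)"
proof -
  obtain Hi where Hi: "Hi \<in> polyfun k" "\<And>x y. jeval (s i) x y = Hi (curve i x y)"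
    using section_polyfun[OF s, of i] by blast
  obtain Hj where Hj: "Hj \<in> polyfun k" "\<And>x y. jeval (s j) x y = Hj (curve j x y)"
    using section_polyfun[OF s, of j] by blast
  from polyfun_dehomogenize[OF Hi(1), of i] obtain m Qi where Qi: "Qi \<in> polyfun k"
    "\<And>X. fps_nth (X i) 0 \<noteq> 0 \<Longrightarrow> fps_nth (X i) 0 ^ m * Hi (\<lambda>t. X t * inverse (X i)) = Qi X" by blast
  from polyfun_dehomogenize[OF Hj(1), of j] obtain n Qj where Qj: "Qj \<in> polyfun k"
    "\<And>X. fps_nth (X j) 0 \<noteq> 0 \<Longrightarrow> fps_nth (X j) 0 ^ n * Hj (\<lambda>t. X t * inverse (X j)) = Qj X" by blast
  define A where "A X = fps_nth (X i) 0 ^ d * Qi X" for X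
  define B where "B X = fps_nth (X j) 0 ^ d * Qj X" for X
  have AB: "A \<in> polyfun k" "B \<in> polyfun k"
    unfolding A_def B_def by (intro polyfun_mult polyfun_power polyfun_var Qi(1) Qj(1); simp)+
  let ?l = "\<lambda>X. fps_nth (X j) 0 ^ n * A X" and ?r = "\<lambda>X. fps_nth (X i) 0 ^ m * B X"
  have lr: "?l \<in> polyfun k" "?r \<in> polyfun k"
    by (intro polyfun_mult polyfun_power polyfun_var AB; simp)+
  have lr0: "?l X = ?r X" if X: "fps_nth (X i) 0 \<noteq> 0" "fps_nth (X j) 0 \<noteq> 0" for X
    using section_homogeneous_eq[OF s Hi(2) Hj(2) X] unfolding A_def B_def Qi(2)[of X, OF X(1), symmetric] Qj(2)[of X, OF X(2), symmetric]
    by (simp add: mult_ac)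
  \<comment> \<open>The extra factor makes both sides vanish at X_j(0) = 0, so only the condition at
    \<open>i\<close> remains for \<open>polyfun_eqI\<close>.\<close>
  have lr_j: "fps_nth (X j) 0 ^ 1 * ?l X = fps_nth (X j) 0 ^ 1 * ?r X" for X
  proof (rule polyfun_eqI[of "\<lambda>X. fps_nth (X j) 0 ^ 1 * ?l X" k "\<lambda>X. fps_nth (X j) 0 ^ 1 * ?r X" i])
    show "(\<lambda>X. fps_nth (X j) 0 ^ 1 * ?l X) \<in> polyfun k" "(\<lambda>X. fps_nth (X j) 0 ^ 1 * ?r X) \<in> polyfun k"
      by (intro polyfun_mult[OF polyfun_power[OF polyfun_var]] lr; simp)+
    show "fps_nth (X j) 0 ^ 1 * ?l X = fps_nth (X j) 0 ^ 1 * ?r X" if "fps_nth (X i) 0 \<noteq> 0" for X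
      using lr0[of X, OF that]
      by (cases "fps_nth (X j) 0 = 0") simp_all
  qed
  have "?l X = ?r X" for X
    by (rule polyfun_cancel[OF lr lr_j])
  from polyfun_coprime_divide[OF ij AB this] obtain P where P: "P \<in> polyfun k"
    "\<And>X. A X = fps_nth (X i) 0 ^ m * P X" by blast
  \<comment> \<open>Where X_i(0) is nonzero, \<open>P\<close> is the homogenisation itself; the
    ratios X_t / X_i ignore a common unit, which gives covariance.\<close>
  have PF: "P X = fps_nth (X i) 0 ^ d * Hi (\<lambda>t. X t * inverse (X i))" if X: "fps_nth (X i) 0 \<noteq> 0" for X
  proof -
    have "fps_nth (X i) 0 ^ m * P X = fps_nth (X i) 0 ^ m * (fps_nth (X i) 0 ^ d * Hi (\<lambda>t. X t * inverse (X i)))"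
      unfolding P(2)[symmetric] A_def Qi(2)[of X, OF X, symmetric] by (simp add: mult_ac)
    then show ?thesis using X by simp
  qed
  have "P (\<lambda>t. c * X t) = fps_nth c 0 ^ d * P X" if c: "fps_nth c 0 \<noteq> 0" for c X
  proof (rule polyfun_eqI[of "\<lambda>X. P (\<lambda>t. c * X t)" k "\<lambda>X. fps_nth c 0 ^ d * P X" i])
    show "(\<lambda>X. P (\<lambda>t. c * X t)) \<in> polyfun k" by (rule polyfun_scale[OF P(1)])
    show "(\<lambda>X. fps_nth c 0 ^ d * P X) \<in> polyfun k" by (intro polyfun_mult polyfun_const P(1))
    show "P (\<lambda>t. c * X t) = fps_nth c 0 ^ d * P X" if X: "fps_nth (X i) 0 \<noteq> 0" for X
    proof -
      have "c * X t * inverse (c * X i) = X t * inverse (X i) * (c * inverse c)" for t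
        by (simp add: fps_inverse_mult mult_ac)
      then have "(\<lambda>t. c * X t * inverse (c * X i)) = (\<lambda>t. X t * inverse (X i))"
        unfolding inverse_mult_eq_1'[OF c] mult_1_right by (rule ext)
      moreover have "P (\<lambda>t. c * X t) = fps_nth (c * X i) 0 ^ d * Hi (\<lambda>t. c * X t * inverse (c * X i))"
        using X c by (intro PF) simp
      ultimately show ?thesis by (simp add: PF[of X, OF X] power_mult_distrib)
    qed
  qed
  then have "P \<in> covariant k d" using P(1) by (simp add: covariant_def)
  moreover have "jeval (s i) x y = P (curve i x y)" for x y
    using PF[of "curve i x y"] by (simp add: Hi(2) curve_def[of i x y i])
  ultimately show ?thesis by blast
qed

section \<open>The dimension\<close>

lemma jeval_sum_scale_sections:
  "jeval ((\<Sum>w\<in>A. scale_sections (c w) (S w)) i) x y = (\<Sum>w\<in>A. c w * jeval (S w i) x y)"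
  by (induction A rule: infinite_finite_induct)
    (simp_all add: jeval_add scale_sections_def jeval_mult jeval_coeff_poly)

text \<open>A curve with X_i(0) nonzero is a unit times a normalised curve, so covariance and
  density carry a relation from normalised curves to all curves.\<close>

lemma word_poly_independent_curves:
  fixes c :: "'n::finite list \<Rightarrow> complex"
  assumes 0: "\<And>x y. (\<Sum>w\<in>words d. c w * word_poly w (curve i x y)) = 0" and w: "w \<in> words d"
  shows "c w = 0"
proof (rule word_poly_independent[OF _ w])
  define P where "P X = (\<Sum>w\<in>words d. c w * word_poly w X)" for X
  have cov: "word_poly w \<in> covariant d d" if "w \<in> words d" for w :: "'n list"
    using that word_poly_covariant[of w d] by (simp add: words_def)
  have P: "P \<in> polyfun d"
    unfolding P_def using cov by (intro polyfun_sum finite_words polyfun_mult polyfun_const) (simp add: covariant_def)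
  have "P X = 0" for X
  proof (rule polyfun_eqI[OF P polyfun_const[of 0], of i])
    fix X :: "'n \<Rightarrow> complex fps" assume X: "fps_nth (X i) 0 \<noteq> 0"
    have *: "P (\<lambda>t. inverse (X i) * X t) = fps_nth (inverse (X i)) 0 ^ d * P X"
    proof -
      have "word_poly w (\<lambda>t. inverse (X i) * X t) = fps_nth (inverse (X i)) 0 ^ d * word_poly w X"
        if "w \<in> words d" for w
        using cov[OF that] X by (simp add: covariant_def)
      then show ?thesis
        unfolding P_def sum_distrib_left by (intro sum.cong refl) (simp only: mult.left_commute)
    qed
    have "curve i (\<chi> t. fps_nth (inverse (X i) * X t) 0) (\<lambda>(t, l). fact l * fps_nth (inverse (X i) * X t) l) =
        (\<lambda>t. inverse (X i) * X t)"
      by (rule curve_jets[where X = "\<lambda>t. inverse (X i) * X t"]) (rule inverse_mult_eq_1[OF X])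
    then have "P (\<lambda>t. inverse (X i) * X t) = 0"
      using 0 unfolding P_def by metis
    with X show "P X = 0" unfolding * by simp
  qed
  then show "(\<Sum>w\<in>words d. c w * word_poly w X) = 0" for X
    unfolding P_def .
qed

theorem theorem1p1:
  fixes N d k :: nat
  assumes "N \<ge> 1" and "CARD('n::finite) = N + 1"
    and "d \<ge> 1" and "k \<ge> d - 1"
  shows "jet_sections.dim (GG_global_sections k d :: ('n \<Rightarrow> 'n jet_poly) set) = (N + 1) ^ d"
proof -
  let ?V = "GG_global_sections k d :: ('n \<Rightarrow> 'n jet_poly) set"
  have dk: "d \<le> Suc k" using assms by simp
  have "card {i} < CARD('n)" for i :: 'n using assms by simp
  then obtain i j :: 'n where ij: "i \<noteq> j"
    by (metis UNIV_I UNIV_eq_I less_irrefl singletonI)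
  have "\<exists>S\<in>?V. \<forall>i x y. jeval (S i) x y = word_poly w (curve i x y)" if "w \<in> words d" for w :: "'n list"
  proof -
    have "word_poly w \<in> covariant k d"
      using word_poly_covariant[of w k] that dk by (simp add: words_def)
    then show ?thesis by (rule covariant_section) blast
  qed
  then obtain S where S: "\<And>w. w \<in> words d \<Longrightarrow> S w \<in> ?V"
    "\<And>w i x y. w \<in> words d \<Longrightarrow> jeval (S w i) x y = word_poly w (curve i x y)"
    by metis
  have indep: "c w = 0" if "(\<Sum>w\<in>words d. scale_sections (c w) (S w)) = 0" "w \<in> words d" for c w
  proof (rule word_poly_independent_curves[OF _ that(2), of _ i])
    fix x y
    have "jeval ((\<Sum>w\<in>words d. scale_sections (c w) (S w)) i) x y = 0"
      unfolding that(1) by simp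
    then show "(\<Sum>w\<in>words d. c w * word_poly w (curve i x y)) = 0"
      unfolding jeval_sum_scale_sections by (simp add: S(2))
  qed
  \<comment> \<open>Equal sections for different words would give a nontrivial relation, so the
    image has as many elements as there are words.\<close>
  have inj: "inj_on S (words d)"
  proof (rule inj_onI, rule ccontr)
    fix u v assume uv: "u \<in> words d" "v \<in> words d" "S u = S v" "u \<noteq> v"
    define c where "c w = (if w = u then 1 else 0) - (if w = v then 1 else 0 :: complex)" for w
    have "(\<Sum>w\<in>words d. scale_sections (c w) (S w)) =
        (\<Sum>w\<in>words d. if w = u then S u else 0) - (\<Sum>w\<in>words d. if w = v then S v else 0)"
      unfolding c_def sum_subtractf[symmetric]
      by (intro sum.cong refl) (auto simp: jet_sections.scale_left_diff_distrib)
    also have "\<dots> = 0" using uv by (simp add: finite_words)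
    finally have "c u = 0" using indep uv by blast
    then show False using uv by (simp add: c_def)
  qed
  show ?thesis
  proof (rule jet_sections.dim_unique)
    show "S ` words d \<subseteq> ?V" using S(1) by blast
    show "card (S ` words d) = (N + 1) ^ d"
      using inj by (simp add: card_image card_words assms)
    show "jet_sections.independent (S ` words d)"
    proof (rule jet_sections.independent_if_scalars_zero)
      show "finite (S ` words d)" by (simp add: finite_words)
      fix f v assume "(\<Sum>v\<in>S ` words d. scale_sections (f v) v) = 0" and v: "v \<in> S ` words d"
      then have "(\<Sum>w\<in>words d. scale_sections (f (S w)) (S w)) = 0"
        by (simp add: sum.reindex[OF inj])
      with indep[of "\<lambda>w. f (S w)"] v show "f v = 0" by blast
    qed
    show "?V \<subseteq> jet_sections.span (S ` words d)"
    proof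
      fix s assume s: "s \<in> ?V"
      from section_covariant[OF s ij] obtain P where P: "P \<in> covariant k d"
        "\<And>x y. jeval (s i) x y = P (curve i x y)" by blast
      from covariant_span[OF P(1) dk] obtain c where c: "\<And>X. P X = (\<Sum>w\<in>words d. c w * word_poly w X)" by blast
      define r where "r = (\<Sum>w\<in>words d. scale_sections (c w) (S w))"
      have "r \<in> ?V"
        unfolding r_def using S(1)
        by (intro jet_sections.subspace_sum jet_sections.subspace_scale GG_global_sections_subspace)
      then have "s - r \<in> ?V"
        by (intro jet_sections.subspace_diff GG_global_sections_subspace s)
      \<comment> \<open>Agreement in the single chart \<open>i\<close> suffices by
        \<open>section_eq_0\<close>.\<close>
      moreover have "jeval ((s - r) i) x y = 0" for x y
      proof -
        have "jeval (s i) x y = jeval ((s - r) i) x y + jeval (r i) x y"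
          by (simp flip: jeval_add)
        moreover have "jeval (r i) x y = P (curve i x y)"
          unfolding r_def jeval_sum_scale_sections c by (simp add: S(2))
        ultimately show ?thesis by (simp add: P(2))
      qed
      ultimately have "s - r = 0" by (rule section_eq_0)
      then have "s = r" by simp
      also have "r \<in> jet_sections.span (S ` words d)"
        unfolding r_def by (intro jet_sections.span_sum jet_sections.span_scale jet_sections.span_base imageI)
      finally show "s \<in> jet_sections.span (S ` words d)" .
    qed
  qed
qed

end
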